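(* Let $t$ be a real number with $0<|t|<1$, and let $P(t)$ be the CR Paneitz operator on the Rossi sphere $(S^3_t, T^{1,0}S^3_t,\theta)$. Then $P(t)$ has infinitely many negative eigenvalues counted without multiplicity.
   Context: Pseudo-Hermitian manifolds. Let $M$ be a closed smooth three-dimensional manifold. A CR structure is a complex line subbundle $T^{1,0}M\subset TM\otimes\mathbb{C}$ with $T^{1,0}M\cap T^{0,1}M=0$, where $T^{0,1}M=\overline{T^{1,0}M}$. It is strictly pseudoconvex if there is a nowhere-vanishing real one-form $\theta$ (a contact form) annihilating $T^{1,0}M$ with $-\sqrt{-1}\,d\theta(Z,\overline Z)>0$ for all $0\ne Z\in T^{1,0}M$; then $(M,T^{1,0}M,\theta)$ is called a pseudo-Hermitian manifold. The Reeb vector field $T$ is determined by $\theta(T)=1$, $d\theta(T,\cdot)=0$. For a local frame $Z_1$ of $T^{1,0}M$ put $Z_{\bar 1}=\overline{Z_1}$, and let $(\theta,\theta^1,\theta^{\bar1})$ be the coframe dual to $(T,Z_1,Z_{\bar1})$. Write $d\theta=\sqrt{-1}\,l_{1\bar1}\,\theta^1\wedge\theta^{\bar1}$ with $l_{1\bar1}>0$, and $l^{1\bar1}=1/l_{1\bar1}$. The Tanaka-Webster connection form ${\omega_1}^1$ and torsion ${A^1}_{\bar1}$ are determined by $d\theta^1=\theta^1\wedge{\omega_1}^1+{A^1}_{\bar1}\,\theta\wedge\theta^{\bar1}$ and $dl_{1\bar1}={\omega_1}^1l_{1\bar1}+l_{1\bar1}{\omega_{\bar1}}^{\bar1}$,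 where ${\omega_{\bar1}}^{\bar1}=\overline{{\omega_1}^1}$; put $A^{\bar1\bar1}=l^{1\bar1}\,\overline{{A^1}_{\bar1}}$. CR Paneitz operator. The Kohn Laplacian is $\Box_b u=-l^{1\bar1}\big(Z_1Z_{\bar1}u-{\omega_{\bar1}}^{\bar1}(Z_1)Z_{\bar1}u\big)$, its complex conjugate is $\overline{\Box}_b u=\overline{\Box_b\overline u}$, and $\mathcal{Q}u=\sqrt{-1}\,\big(Z_{\bar1}+{\omega_{\bar1}}^{\bar1}(Z_{\bar1})\big)\big(A^{\bar1\bar1}Z_{\bar1}u\big)$; these are independent of the choice of $Z_1$. The CR Paneitz operator is the fourth-order differential operator $P=\overline{\Box}_b\Box_b+\mathcal{Q}$. It is considered as an operator on $L^2(M)$ (volume form $\theta\wedge d\theta$) via its maximal closed extension, with domain $\{u\in L^2(M): Pu\in L^2(M)\text{ in the sense of distributions}\}$, which is self-adjoint. Rossi sphere. On the unit sphere $S^3=\{(z,w)\in\mathbb{C}^2: |z|^2+|w|^2=1\}$ let $Z_1=\overline w\,\partial_z-\overline z\,\partial_w$, $Z_{\bar1}=\overline{Z_1}$, and $\theta=\frac{\sqrt{-1}}{2}(z\,d\overline z+w\,d\overline w-\overline z\,dz-\overline w\,dw)|_{S^3}$. For real $t$ with $0<|t|<1$ the Rossi sphere is $(S^3_t,T^{1,0}S^3_t)=(S^3,\mathbb{C}(Z_1+tZ_{\bar1}))$; with $\theta$ it is a closed pseudo-Hermitian manifold of dimension three. *)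

theory Defs
  imports "HOL-Analysis.Analysis"
begin

section \<open>Calculus on the unit sphere of \<open>\<complex>\<^sup>2\<close>\<close>

type_synonym c2 = "complex \<times> complex"

abbreviation S3 :: "c2 set" where
  "S3 \<equiv> sphere 0 1"

text \<open>
  A function on \<open>S3\<close> is represented by a function on all of \<open>c2\<close> of which only the values on
  \<open>S3\<close> matter. Composing with the radial retraction \<open>sgn x = x /\<^sub>R norm x\<close> gives an extension
  to the complement of the origin that depends on these values only; its derivative in a direction
  tangent to \<open>S3\<close> is the derivative of the function on the manifold \<open>S3\<close>.
\<close>

definition tangent :: "c2 \<Rightarrow> c2 set" where
  "tangent p = {a. p \<bullet> a = 0}"

definition sphere_deriv :: "(c2 \<Rightarrow> 'b::real_normed_vector) \<Rightarrow> c2 \<Rightarrow> c2 \<Rightarrow> 'b" where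
  "sphere_deriv u p a = frechet_derivative (\<lambda>x. u (sgn x)) (at p) a"

primrec Ck_on :: "nat \<Rightarrow> 'a::real_normed_vector set \<Rightarrow> ('a \<Rightarrow> 'b::real_normed_vector) \<Rightarrow> bool" where
  "Ck_on 0 U f = continuous_on U f"
| "Ck_on (Suc k) U f =
     ((\<forall>x\<in>U. f differentiable at x) \<and> (\<forall>v. Ck_on k U (\<lambda>x. frechet_derivative f (at x) v)))"

definition smooth_S3 :: "(c2 \<Rightarrow> complex) \<Rightarrow> bool" where
  "smooth_S3 u \<longleftrightarrow> (\<exists>U g. open U \<and> S3 \<subseteq> U \<and> (\<forall>k. Ck_on k U g) \<and> (\<forall>x\<in>S3. g x = u x))"

text \<open>
  A complex tangent vector \<open>a + i b\<close> is the pair \<open>(a, b)\<close> of its real and imaginary part.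
  Complex-valued one-forms and two-forms at a point are given by their values on real tangent
  vectors; \<open>cext\<close> extends a one-form complex-linearly.
\<close>

type_synonym cvec = "c2 \<times> c2"

type_synonym form1 = "c2 \<Rightarrow> c2 \<Rightarrow> complex"

definition cscale :: "complex \<Rightarrow> cvec \<Rightarrow> cvec" where
  "cscale c V = (Re c *\<^sub>R fst V - Im c *\<^sub>R snd V, Re c *\<^sub>R snd V + Im c *\<^sub>R fst V)"

definition conj_vec :: "cvec \<Rightarrow> cvec" where
  "conj_vec V = (fst V, - snd V)"

definition cext :: "(c2 \<Rightarrow> complex) \<Rightarrow> cvec \<Rightarrow> complex" where
  "cext \<alpha> V = \<alpha> (fst V) + \<i> * \<alpha> (snd V)"

definition vf_apply :: "(c2 \<Rightarrow> cvec) \<Rightarrow> (c2 \<Rightarrow> complex) \<Rightarrow> c2 \<Rightarrow> complex" where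
  "vf_apply Z u p = cext (sphere_deriv u p) (Z p)"

definition wedge :: "(c2 \<Rightarrow> complex) \<Rightarrow> (c2 \<Rightarrow> complex) \<Rightarrow> c2 \<Rightarrow> c2 \<Rightarrow> complex" where
  "wedge \<alpha> \<beta> a b = \<alpha> a * \<beta> b - \<alpha> b * \<beta> a"

definition conj_form :: "(c2 \<Rightarrow> complex) \<Rightarrow> c2 \<Rightarrow> complex" where
  "conj_form \<alpha> a = cnj (\<alpha> a)"

text \<open>
  The form \<open>\<alpha>\<close> on \<open>S3\<close> is extended to the complement of the origin using the radial
  retraction and the orthogonal projection onto the tangent spaces of \<open>S3\<close>. As pullback to
  \<open>S3\<close> commutes with the exterior derivative, the formula for the exterior derivative of the
  extension, evaluated at \<open>p\<close> on vectors tangent to \<open>S3\<close>, gives \<open>d\<alpha>\<close>. The convention is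
  \<open>d\<alpha>(X,Y) = X \<alpha>(Y) - Y \<alpha>(X) - \<alpha>([X,Y])\<close>, in accordance with \<open>wedge\<close>.
\<close>

definition tangent_proj :: "c2 \<Rightarrow> c2 \<Rightarrow> c2" where
  "tangent_proj q v = v - (q \<bullet> v) *\<^sub>R q"

definition form_ext :: "form1 \<Rightarrow> form1" where
  "form_ext \<alpha> x v = \<alpha> (sgn x) (tangent_proj (sgn x) v)"

definition ext_deriv :: "form1 \<Rightarrow> c2 \<Rightarrow> c2 \<Rightarrow> c2 \<Rightarrow> complex" where
  "ext_deriv \<alpha> p a b =
     frechet_derivative (\<lambda>x. form_ext \<alpha> x b) (at p) a -
     frechet_derivative (\<lambda>x. form_ext \<alpha> x a) (at p) b"


section \<open>Pseudo-Hermitian geometry\<close>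

text \<open>
  Throughout, \<open>\<theta>\<close> is a contact form on \<open>S3\<close> and \<open>Z\<close> is a global frame of the CR structure
  \<open>T\<^sup>1\<^sup>,\<^sup>0\<close>. The operators below do not depend on the choice of \<open>Z\<close>.
\<close>

definition reeb :: "form1 \<Rightarrow> c2 \<Rightarrow> c2" where
  "reeb \<theta> p = (THE v. v \<in> tangent p \<and> \<theta> p v = 1 \<and> (\<forall>a\<in>tangent p. ext_deriv \<theta> p v a = 0))"

text \<open>
  \<open>theta1 \<theta> Z\<close> is the member \<open>\<theta>\<^sup>1\<close> of the coframe dual to \<open>(T, Z, conj Z)\<close>: it reads off the
  coefficient of \<open>Z\<close>.
\<close>

definition theta1 :: "form1 \<Rightarrow> (c2 \<Rightarrow> cvec) \<Rightarrow> form1" where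
  "theta1 \<theta> Z p v =
     (THE c. \<exists>c0 c'. (v, 0) = cscale c0 (reeb \<theta> p, 0) + cscale c (Z p) + cscale c' (conj_vec (Z p)))"

definition theta1bar :: "form1 \<Rightarrow> (c2 \<Rightarrow> cvec) \<Rightarrow> form1" where
  "theta1bar \<theta> Z p = conj_form (theta1 \<theta> Z p)"

definition levi :: "form1 \<Rightarrow> (c2 \<Rightarrow> cvec) \<Rightarrow> c2 \<Rightarrow> real" where
  "levi \<theta> Z p = (THE l. \<forall>a\<in>tangent p. \<forall>b\<in>tangent p.
     ext_deriv \<theta> p a b = \<i> * of_real l * wedge (theta1 \<theta> Z p) (theta1bar \<theta> Z p) a b)"

definition tanaka_webster :: "form1 \<Rightarrow> (c2 \<Rightarrow> cvec) \<Rightarrow> form1 \<Rightarrow> (c2 \<Rightarrow> complex) \<Rightarrow> bool" where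
  "tanaka_webster \<theta> Z \<omega> A \<longleftrightarrow> (\<forall>p\<in>S3.
     linear (\<omega> p) \<and>
     (\<forall>a\<in>tangent p. \<forall>b\<in>tangent p.
        ext_deriv (theta1 \<theta> Z) p a b =
          wedge (theta1 \<theta> Z p) (\<omega> p) a b + A p * wedge (\<theta> p) (theta1bar \<theta> Z p) a b) \<and>
     (\<forall>a\<in>tangent p.
        of_real (sphere_deriv (levi \<theta> Z) p a) =
          \<omega> p a * of_real (levi \<theta> Z p) + of_real (levi \<theta> Z p) * conj_form (\<omega> p) a))"

text \<open>
  The structure equations determine \<open>\<omega>\<close> on the tangent spaces of \<open>S3\<close> and \<open>A\<close> on \<open>S3\<close>, and
  only these values are used below, so that any choice gives the same operators.
\<close>

definition tw_pair :: "form1 \<Rightarrow> (c2 \<Rightarrow> cvec) \<Rightarrow> form1 \<times> (c2 \<Rightarrow> complex)" where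
  "tw_pair \<theta> Z = (SOME x. tanaka_webster \<theta> Z (fst x) (snd x))"

definition omega11 :: "form1 \<Rightarrow> (c2 \<Rightarrow> cvec) \<Rightarrow> form1" where
  "omega11 \<theta> Z = fst (tw_pair \<theta> Z)"

definition omega11bar :: "form1 \<Rightarrow> (c2 \<Rightarrow> cvec) \<Rightarrow> form1" where
  "omega11bar \<theta> Z p = conj_form (omega11 \<theta> Z p)"

definition torsion :: "form1 \<Rightarrow> (c2 \<Rightarrow> cvec) \<Rightarrow> c2 \<Rightarrow> complex" where
  "torsion \<theta> Z = snd (tw_pair \<theta> Z)"

definition torsion_up :: "form1 \<Rightarrow> (c2 \<Rightarrow> cvec) \<Rightarrow> c2 \<Rightarrow> complex" where
  "torsion_up \<theta> Z p = of_real (1 / levi \<theta> Z p) * cnj (torsion \<theta> Z p)"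

definition kohn_laplacian :: "form1 \<Rightarrow> (c2 \<Rightarrow> cvec) \<Rightarrow> (c2 \<Rightarrow> complex) \<Rightarrow> c2 \<Rightarrow> complex" where
  "kohn_laplacian \<theta> Z u p =
     (let Zbar = \<lambda>q. conj_vec (Z q) in
      - of_real (1 / levi \<theta> Z p) *
        (vf_apply Z (vf_apply Zbar u) p - cext (omega11bar \<theta> Z p) (Z p) * vf_apply Zbar u p))"

definition kohn_laplacian_conj :: "form1 \<Rightarrow> (c2 \<Rightarrow> cvec) \<Rightarrow> (c2 \<Rightarrow> complex) \<Rightarrow> c2 \<Rightarrow> complex" where
  "kohn_laplacian_conj \<theta> Z u p = cnj (kohn_laplacian \<theta> Z (\<lambda>q. cnj (u q)) p)"

definition Q_op :: "form1 \<Rightarrow> (c2 \<Rightarrow> cvec) \<Rightarrow> (c2 \<Rightarrow> complex) \<Rightarrow> c2 \<Rightarrow> complex" where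
  "Q_op \<theta> Z u p =
     (let Zbar = \<lambda>q. conj_vec (Z q);
          f = \<lambda>q. torsion_up \<theta> Z q * vf_apply Zbar u q
      in \<i> * (vf_apply Zbar f p + cext (omega11bar \<theta> Z p) (Zbar p) * f p))"

definition paneitz :: "form1 \<Rightarrow> (c2 \<Rightarrow> cvec) \<Rightarrow> (c2 \<Rightarrow> complex) \<Rightarrow> c2 \<Rightarrow> complex" where
  "paneitz \<theta> Z u p = kohn_laplacian_conj \<theta> Z (kohn_laplacian \<theta> Z u) p + Q_op \<theta> Z u p"


section \<open>The maximal closed extension in \<open>L\<^sup>2\<close>\<close>

text \<open>
  The measure on (the Borel sets of) \<open>S3\<close> defined by the volume form \<open>\<theta> \<and> d\<theta>\<close>, computed in the coordinates
  \<open>hopf\<close>, which cover \<open>S3\<close> injectively up to a set of measure zero. The absolute value takes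
  care of the orientation of these coordinates.
\<close>

definition vol_form :: "form1 \<Rightarrow> c2 \<Rightarrow> c2 \<Rightarrow> c2 \<Rightarrow> c2 \<Rightarrow> complex" where
  "vol_form \<theta> p a b c =
     \<theta> p a * ext_deriv \<theta> p b c + \<theta> p b * ext_deriv \<theta> p c a + \<theta> p c * ext_deriv \<theta> p a b"

definition hopf :: "real \<times> real \<times> real \<Rightarrow> c2" where
  "hopf y = (case y of (\<eta>, \<alpha>, \<beta>) \<Rightarrow> (of_real (cos \<eta>) * cis \<alpha>, of_real (sin \<eta>) * cis \<beta>))"

definition vol :: "form1 \<Rightarrow> c2 measure" where
  "vol \<theta> = distr
     (density (restrict_space lborel (box (0, 0, 0) (pi / 2, 2 * pi, 2 * pi)))
       (\<lambda>y. let D = frechet_derivative hopf (at y)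
            in ennreal (norm (vol_form \<theta> (hopf y) (D (1, 0, 0)) (D (0, 1, 0)) (D (0, 0, 1))))))
     (restrict_space borel S3) hopf"

definition L2 :: "form1 \<Rightarrow> (c2 \<Rightarrow> complex) set" where
  "L2 \<theta> = {u \<in> borel_measurable (vol \<theta>). integrable (vol \<theta>) (\<lambda>x. (norm (u x))\<^sup>2)}"

definition L2_inner :: "form1 \<Rightarrow> (c2 \<Rightarrow> complex) \<Rightarrow> (c2 \<Rightarrow> complex) \<Rightarrow> complex" where
  "L2_inner \<theta> u v = integral\<^sup>L (vol \<theta>) (\<lambda>x. u x * cnj (v x))"

text \<open>
  \<open>formal_adjoint \<theta> P \<phi> \<phi>'\<close> says that the formal adjoint of the differential operator \<open>P\<close> maps
  the test function \<open>\<phi>\<close> to \<open>\<phi>'\<close>. The operator \<open>P\<close> applied to \<open>u\<close> in the sense of distributions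
  is obtained by moving the formal adjoint of \<open>P\<close> to the test function.
\<close>

definition formal_adjoint ::
  "form1 \<Rightarrow> ((c2 \<Rightarrow> complex) \<Rightarrow> c2 \<Rightarrow> complex) \<Rightarrow> (c2 \<Rightarrow> complex) \<Rightarrow> (c2 \<Rightarrow> complex) \<Rightarrow> bool" where
  "formal_adjoint \<theta> P \<phi> \<phi>' \<longleftrightarrow>
     smooth_S3 \<phi> \<and> smooth_S3 \<phi>' \<and>
     (\<forall>\<psi>. smooth_S3 \<psi> \<longrightarrow> L2_inner \<theta> (P \<psi>) \<phi> = L2_inner \<theta> \<psi> \<phi>')"

definition max_extension ::
  "form1 \<Rightarrow> ((c2 \<Rightarrow> complex) \<Rightarrow> c2 \<Rightarrow> complex) \<Rightarrow> (c2 \<Rightarrow> complex) \<Rightarrow> (c2 \<Rightarrow> complex) \<Rightarrow> bool" where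
  "max_extension \<theta> P u f \<longleftrightarrow>
     u \<in> L2 \<theta> \<and> f \<in> L2 \<theta> \<and>
     (\<forall>\<phi> \<phi>'. formal_adjoint \<theta> P \<phi> \<phi>' \<longrightarrow> L2_inner \<theta> u \<phi>' = L2_inner \<theta> f \<phi>)"

definition paneitz_eigenvalue :: "form1 \<Rightarrow> (c2 \<Rightarrow> cvec) \<Rightarrow> complex \<Rightarrow> bool" where
  "paneitz_eigenvalue \<theta> Z c \<longleftrightarrow>
     (\<exists>u. max_extension \<theta> (paneitz \<theta> Z) u (\<lambda>x. c * u x) \<and> \<not> (AE x in vol \<theta>. u x = 0))"


section \<open>The Rossi sphere\<close>

definition d_z :: cvec where
  "d_z = ((1 / 2, 0), (- \<i> / 2, 0))"

definition d_w :: cvec where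
  "d_w = ((0, 1 / 2), (0, - \<i> / 2))"

definition Z1 :: "c2 \<Rightarrow> cvec" where
  "Z1 p = (case p of (z, w) \<Rightarrow> cscale (cnj w) d_z - cscale (cnj z) d_w)"

definition theta_S3 :: form1 where
  "theta_S3 p v = (case p of (z, w) \<Rightarrow> case v of (dz, dw) \<Rightarrow>
     \<i> / 2 * (z * cnj dz + w * cnj dw - cnj z * dz - cnj w * dw))"

definition rossi_frame :: "real \<Rightarrow> c2 \<Rightarrow> cvec" where
  "rossi_frame t p = Z1 p + cscale (of_real t) (conj_vec (Z1 p))"

end

theory Submission
  imports Defs "HOL-Real_Asymp.Real_Asymp"
begin

text \<open>
  For the Rossi frame \<open>Z\<close> the Levi form is \<open>1 - t\<^sup>2\<close>, the torsion is constant and the connection form is a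
  multiple of \<open>\<theta>\<close>, so that \<open>(1 - t\<^sup>2)\<^sup>2 P = Z' (Z\<^sup>2 + 4 t) Z'\<close> with \<open>Z'\<close> the conjugate of \<open>Z\<close>. This operator
  preserves the space of homogeneous polynomials of degree \<open>m\<close> in \<open>z\<close> and \<open>cnj w\<close>, where it becomes a real
  matrix that is symmetric for the \<open>L\<^sup>2\<close> inner product. For odd \<open>m\<close>, truncating a formal solution of
  \<open>(Z\<^sup>2 + 4 t) Z' u = 0\<close> gives a vector \<open>u\<close> for which \<open>P u\<close> is exponentially small compared to \<open>u\<close>,
  with \<open>\<langle>P u, u\<rangle> < 0\<close> and \<open>\<parallel>P u\<parallel>\<^sup>2 < \<epsilon> \<bar>\<langle>P u, u\<rangle>\<bar>\<close> for large \<open>m\<close>. By the spectral theorem the matrix has an eigenvalue between \<open>-\<epsilon>\<close>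
  and \<open>0\<close>. As \<open>\<epsilon>\<close> is arbitrary, infinitely many negative eigenvalues occur. Polynomial eigenfunctions are
  smooth, hence eigenfunctions of the maximal extension.
\<close>

section \<open>Eigenvalues of symmetric matrices\<close>

text \<open>Eigenvalues are counted without multiplicity and those of different degrees might
  coincide, so one negative eigenvalue per degree is not enough; eigenvalues approaching 0 from
  below are. An eigenvalue \<lambda> outside (-\<epsilon>, 0) has \<lambda>^2 + \<epsilon> \<lambda>
  \<ge> 0, so a vector with negative form T^2 + \<epsilon> T forces one inside. Odd m matters twice.
  The exponent m/2 - 1 is then not an integer, so the series does not terminate and truncation
  leaves a nonzero defect; for even m \<ge> 2 it is a polynomial and an exact solution. Also, there
  are as many odd as even powers of z, so that solving for u with Z' u equal to the truncation is a
  square triangular system. With m = 2 K + 1, back in u the coefficients carry negative powers of t,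
  and the top one cancels the factor t^(K+1) of the defect in the pairing of P u with u, while the
  squared norm of P u keeps t^(2K+2). It remains to compare two sequences free of t,
  \<open>half_binom\<close> and \<open>homogeneous_coeff\<close>, up to polynomial factors in
  K.\<close>

lemma nonneg_quadratic_imp_linear_zero:
  fixes L R :: real
  assumes "\<And>s. 0 \<le> 2 * s * L + s\<^sup>2 * R"
  shows "L = 0"
proof (rule ccontr)
  assume "L \<noteq> 0"
  \<comment> \<open>At s = -L / C the value is L^2 (R - 2 C) / C^2, which is negative whatever the
    sign of R because C > \<bar>R\<bar>.\<close>
  define C where "C = \<bar>R\<bar> + 1"
  have C: "C > 0" "R < C" by (auto simp: C_def)
  have "2 * (- L / C) * L + (- L / C)\<^sup>2 * R = (L\<^sup>2 / C\<^sup>2) * (R - 2 * C)"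
    using C by (simp add: field_simps power2_eq_square)
  also have "\<dots> < 0"
    using C \<open>L \<noteq> 0\<close> by (intro mult_pos_neg) auto
  finally show False using assms[of "- L / C"] by linarith
qed

text \<open>
  The operator \<open>T\<^sup>2 + \<epsilon> T\<close> takes a negative value, so its minimum on the unit sphere is a negative
  eigenvalue \<open>\<mu>\<close>. Then \<open>T\<^sup>2 + \<epsilon> T - \<mu>\<close> splits into linear factors with roots between \<open>-\<epsilon>\<close> and \<open>0\<close>.
\<close>

lemma symmetric_eigenvalue_between:
  fixes T :: "('a \<Rightarrow> real) \<Rightarrow> 'a \<Rightarrow> real" and w u :: "'a \<Rightarrow> real" and I :: "'a set"
  defines "B \<equiv> \<lambda>c d. \<Sum>i\<in>I. w i * c i * d i"
  defines "V \<equiv> {c. \<forall>i. i \<notin> I \<longrightarrow> c i = 0}"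
  assumes "\<epsilon> > 0" and fin: "finite I" and w: "\<And>i. i \<in> I \<Longrightarrow> 0 < w i"
    and lin: "\<And>a b c d. T (\<lambda>i. a * c i + b * d i) = (\<lambda>i. a * T c i + b * T d i)"
    and TV: "\<And>c. c \<in> V \<Longrightarrow> T c \<in> V"
    and cont: "\<And>i. continuous_on UNIV (\<lambda>c. T c i)"
    and sym: "\<And>c d. c \<in> V \<Longrightarrow> d \<in> V \<Longrightarrow> B (T c) d = B c (T d)"
    and u: "u \<in> V" "B (T u) (T u) + \<epsilon> * B (T u) u < 0"
  shows "\<exists>r v. - \<epsilon> < r \<and> r < 0 \<and> v \<in> V \<and> v \<noteq> (\<lambda>_. 0) \<and> T v = (\<lambda>i. r * v i)"
proof -
  have Bsym: "B c d = B d c" for c d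
    unfolding B_def by (simp add: mult_ac)
  have Blin: "B (\<lambda>i. a * c i + b * d i) e = a * B c e + b * B d e" for a b c d e
    unfolding B_def by (simp add: sum_distrib_left sum.distrib algebra_simps)
  have Blin2: "B e (\<lambda>i. a * c i + b * d i) = a * B e c + b * B e d" for a b c d e
    using Blin Bsym by metis
  have Bnn: "0 \<le> B c c" for c
    unfolding B_def using w by (intro sum_nonneg) (simp add: mult.assoc less_imp_le)
  have Bz: "c = (\<lambda>_. 0)" if "c \<in> V" "B c c = 0" for c
  proof
    fix i
    show "c i = 0"
    proof (cases "i \<in> I")
      case True
      have "\<forall>i\<in>I. w i * c i * c i = 0"
        using that(2) fin w unfolding B_def
        by (subst (asm) sum_nonneg_eq_0_iff) (auto simp: mult.assoc less_imp_le)
      then show ?thesis using True w by fastforce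
    qed (use that in \<open>auto simp: V_def\<close>)
  qed
  have Vlin: "(\<lambda>i. a * c i + b * d i) \<in> V" if "c \<in> V" "d \<in> V" for a b c d
    using that by (auto simp: V_def)
  define Q where "Q = (\<lambda>c. B (T c) (T c) + \<epsilon> * B (T c) c)"
  define S where "S = {c \<in> V. B c c = 1}"
  have coordc: "continuous_on A (\<lambda>c::'a \<Rightarrow> real. c i)" for A i
    by (rule continuous_on_product_then_coordinatewise[OF continuous_on_id])
  have Tc: "continuous_on A (\<lambda>c. T c i)" for A i
    using cont continuous_on_subset by blast
  have "compact S"
  proof -
    \<comment> \<open>The summand 1 yields 1 \<le> M, hence M \<le> M^2, so that the bound 1 / w i
      on the square of c i bounds c i itself.\<close>
    define M where "M = Max (insert 0 ((\<lambda>i. 1 / w i) ` I)) + 1"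
    have M: "1 / w i \<le> M" "1 \<le> M" if "i \<in> I" for i
    proof -
      have "1 / w i \<le> Max (insert 0 ((\<lambda>i. 1 / w i) ` I))" using fin that by (intro Max_ge) auto
      then show "1 / w i \<le> M" by (simp add: M_def)
      have "0 \<le> Max (insert 0 ((\<lambda>i. 1 / w i) ` I))" using fin by (intro Max_ge) auto
      then show "1 \<le> M" by (simp add: M_def)
    qed
    define X where "X = (\<lambda>i. if i \<in> I then {- M..M} else {0::real})"
    \<comment> \<open>Tychonoff: in the product topology on all functions the box is compact, since
      its factors outside \<open>I\<close> are singletons.\<close>
    have "compactin (product_topology (\<lambda>_. euclidean) UNIV) (PiE UNIV X)"
      unfolding compactin_PiE X_def by auto
    then have cX: "compact (PiE UNIV X)"
      by (simp add: euclidean_product_topology)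
    have "S = PiE UNIV X \<inter> {c. B c c = 1}"
    proof (intro set_eqI iffI)
      fix c assume c: "c \<in> S"
      have "c i \<in> X i" for i
      proof (cases "i \<in> I")
        case True
        have "w i * c i * c i \<le> B c c"
          unfolding B_def using fin True w by (intro member_le_sum) (auto simp: mult.assoc less_imp_le)
        then have "w i * (c i)\<^sup>2 \<le> 1" using c by (simp add: S_def power2_eq_square mult.assoc)
        then have "(c i)\<^sup>2 \<le> 1 / w i" using w[OF True] by (simp add: field_simps)
        also have "\<dots> \<le> M" by (rule M[OF True])
        also have "\<dots> \<le> M\<^sup>2" using M(2)[OF True] by (simp add: power2_eq_square)
        finally have "\<bar>c i\<bar> \<le> M" using M(2)[OF True] by (simp add: abs_le_square_iff[symmetric])
        then show ?thesis using True by (auto simp: X_def)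
      qed (use c in \<open>auto simp: S_def V_def X_def\<close>)
      then show "c \<in> PiE UNIV X \<inter> {c. B c c = 1}" using c by (auto simp: S_def)
    next
      fix c assume "c \<in> PiE UNIV X \<inter> {c. B c c = 1}"
      then show "c \<in> S" unfolding S_def V_def X_def by (auto simp: PiE_iff split: if_splits)
    qed
    moreover have "closed {c. B c c = 1}"
      unfolding B_def by (intro closed_Collect_eq continuous_intros coordc)
    ultimately show ?thesis using cX by (simp add: compact_Int_closed)
  qed
  moreover have "u \<noteq> (\<lambda>_. 0)"
  proof
    assume "u = (\<lambda>_. 0)"
    then show False using u(2) lin[of 0 u 0 u] by (simp add: B_def)
  qed
  then have Bu: "0 < B u u" using Bz[OF u(1)] Bnn[of u] by fastforce
  have scale: "T (\<lambda>i. a * c i) = (\<lambda>i. a * T c i)" for a c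
    using lin[of a c 0 c] by simp
  have Bscale: "B (\<lambda>i. a * c i) d = a * B c d" "B d (\<lambda>i. a * c i) = a * B d c" for a c d
    using Blin[of a c 0 c] Blin2[of _ a c 0 c] by auto
  have Qscale: "Q (\<lambda>i. a * c i) = a\<^sup>2 * Q c" for a c
    unfolding Q_def by (simp add: scale Bscale power2_eq_square algebra_simps)
  have norm1: "(\<lambda>i. (1 / sqrt (B c c)) * c i) \<in> S" if "c \<in> V" "0 < B c c" for c
    using that unfolding S_def V_def mem_Collect_eq Bscale by (auto simp: field_simps)
  have "S \<noteq> {}" using norm1[OF u(1) Bu] by blast
  moreover have "continuous_on S Q"
    unfolding Q_def B_def by (intro continuous_intros coordc Tc)
  ultimately obtain x where x: "x \<in> S" and xmin: "\<And>c. c \<in> S \<Longrightarrow> Q x \<le> Q c"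
    using continuous_attains_inf by metis
  define \<mu> where "\<mu> = Q x"
  have xV: "x \<in> V" and Bx: "B x x = 1" using x by (auto simp: S_def)
  have Qge: "\<mu> * B c c \<le> Q c" if "c \<in> V" for c
  proof (cases "B c c = 0")
    case True
    then have "c = (\<lambda>_. 0)" using Bz that by blast
    then show ?thesis using Qscale[of 0 c] by (simp add: B_def)
  next
    case False
    then have p: "0 < B c c" using Bnn[of c] by linarith
    have "\<mu> \<le> (1 / sqrt (B c c))\<^sup>2 * Q c"
      using xmin[OF norm1[OF that p]] unfolding \<mu>_def Qscale .
    then show ?thesis using p by (simp add: power_divide field_simps)
  qed
  have "\<mu> < 0"
  proof -
    have "\<mu> * B u u < 0" using Qge[OF u(1)] u(2) by (simp add: Q_def)
    then show ?thesis using Bu by (simp add: mult_less_0_iff)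
  qed
  \<comment> \<open>The residual of the eigenvalue equation at the minimizer \<open>x\<close>. It
    also serves as the direction in which \<open>x\<close> is varied, which makes the first
    variation 2 \<open>B y y\<close>. The factors 1 keep the shape of \<open>lin\<close> and
    \<open>Blin\<close>.\<close>
  define y where "y = (\<lambda>i. 1 * (1 * T (T x) i + \<epsilon> * T x i) + (- \<mu>) * x i)"
  have TxV: "T x \<in> V" "T (T x) \<in> V" using TV xV by auto
  have yV: "y \<in> V" unfolding y_def by (intro Vlin TxV xV)
  have "B y y = 0"
  proof (rule nonneg_quadratic_imp_linear_zero)
    fix s :: real
    define c where "c = (\<lambda>i. 1 * x i + s * y i)"
    have cV: "c \<in> V" unfolding c_def by (intro Vlin xV yV)
    have Tcc: "T c = (\<lambda>i. 1 * T x i + s * T y i)" unfolding c_def by (rule lin)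
    have s1: "B (T x) (T y) = B (T (T x)) y" using sym[OF TxV(1) yV] by simp
    have s2: "B x (T y) = B (T x) y" using sym[OF xV yV] by simp
    have s3: "B y y = B (T (T x)) y + \<epsilon> * B (T x) y - \<mu> * B x y"
      by (subst (1) y_def) (simp only: Blin Blin2, simp)
    have "0 \<le> Q c - \<mu> * B c c" using Qge[OF cV] by simp
    also have "Q c = Q x + 2 * s * (B (T (T x)) y + \<epsilon> * B (T x) y) + s\<^sup>2 * Q y"
      unfolding Q_def Tcc unfolding c_def Blin Blin2
      using s1 s2 Bsym[of "T y" "T x"] Bsym[of "T y" x] Bsym[of "T x" y]
      by (simp add: algebra_simps power2_eq_square)
    also have "B c c = 1 + 2 * s * B x y + s\<^sup>2 * B y y"
      unfolding c_def Blin Blin2 using Bx Bsym[of x y] by (simp add: algebra_simps power2_eq_square)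
    also have "B (T (T x)) y + \<epsilon> * B (T x) y = B y y + \<mu> * B x y" using s3 by simp
    finally show "0 \<le> 2 * s * B y y + s\<^sup>2 * (Q y - \<mu> * B y y)"
      by (simp add: \<mu>_def[symmetric] algebra_simps)
  qed
  then have "y = (\<lambda>_. 0)" using Bz yV by blast
  then have eq: "T (T x) i = \<mu> * x i - \<epsilon> * T x i" for i
    unfolding y_def by (auto dest!: fun_cong[of _ _ i])
  \<comment> \<open>Completing the square: the squared norm of \<open>z\<close> is \<mu> +
    \<epsilon>^2 / 4, so the quadratic has real roots.\<close>
  define z where "z = (\<lambda>i. 1 * T x i + (\<epsilon> / 2) * x i)"
  have "B z z = \<mu> + \<epsilon>\<^sup>2 / 4"
    unfolding z_def Blin Blin2 using Bx Bsym[of x "T x"]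
    by (simp add: \<mu>_def Q_def algebra_simps power2_eq_square)
  then have disc: "0 \<le> \<epsilon>\<^sup>2 / 4 + \<mu>" using Bnn[of z] by simp
  define \<delta> where "\<delta> = sqrt (\<epsilon>\<^sup>2 / 4 + \<mu>)"
  have \<delta>2: "\<delta>\<^sup>2 = \<epsilon>\<^sup>2 / 4 + \<mu>" "0 \<le> \<delta>" using disc by (auto simp: \<delta>_def)
  have "\<delta>\<^sup>2 < (\<epsilon> / 2)\<^sup>2" unfolding \<delta>2(1) power_divide using \<open>\<mu> < 0\<close> by simp
  then have \<delta>3: "\<delta> < \<epsilon> / 2" by (rule power2_less_imp_less) (use \<open>\<epsilon> > 0\<close> in simp)
  show ?thesis
  proof (cases "T x = (\<lambda>i. (- \<epsilon> / 2 + \<delta>) * x i)")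
    case True
    moreover have "x \<noteq> (\<lambda>_. 0)" using Bx by (auto simp: B_def)
    ultimately show ?thesis using \<delta>2(2) \<delta>3 xV by (intro exI[of _ "- \<epsilon> / 2 + \<delta>"] exI[of _ x]) auto
  next
    case False
    \<comment> \<open>If the factor with root -\<epsilon>/2 + \<delta> does not annihilate
      \<open>x\<close>, it maps \<open>x\<close> to an eigenvector for the other root.\<close>
    define v where "v = (\<lambda>i. 1 * T x i + (\<epsilon> / 2 - \<delta>) * x i)"
    have "v \<noteq> (\<lambda>_. 0)"
    proof
      assume "v = (\<lambda>_. 0)"
      then have "T x i = (- \<epsilon> / 2 + \<delta>) * x i" for i
        unfolding v_def by (auto dest!: fun_cong[of _ _ i] simp: algebra_simps)
      then show False using False by blast
    qed
    moreover have "v \<in> V" unfolding v_def by (intro Vlin TxV xV)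
    moreover have "T v = (\<lambda>i. (- \<epsilon> / 2 - \<delta>) * v i)"
    proof
      fix i
      have "T v i = T (T x) i + (\<epsilon> / 2 - \<delta>) * T x i"
        unfolding v_def lin by simp
      also have "\<dots> = (- \<epsilon> / 2 - \<delta>) * T x i + \<mu> * x i"
        unfolding eq by (simp add: algebra_simps)
      also have "\<mu> = (- \<epsilon> / 2 - \<delta>) * (\<epsilon> / 2 - \<delta>)"
        using \<delta>2(1) by (simp add: algebra_simps power2_eq_square)
      finally show "T v i = (- \<epsilon> / 2 - \<delta>) * v i" by (simp add: fun_cong[OF v_def, of i] field_simps)
    qed
    ultimately show ?thesis using \<delta>2(2) \<delta>3 \<open>\<epsilon> > 0\<close>
      by (intro exI[of _ "- \<epsilon> / 2 - \<delta>"] exI[of _ v]) auto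
  qed
qed

section \<open>The Paneitz operator on homogeneous polynomials\<close>

text \<open>
  On polynomials homogeneous of degree \<open>m\<close> in \<open>x = z\<close> and \<open>y = cnj w\<close>, the Rossi frame acts as
  \<open>y \<partial>\<^sub>x - t x \<partial>\<^sub>y\<close> and its conjugate as \<open>t y \<partial>\<^sub>x - x \<partial>\<^sub>y\<close>. A polynomial is represented by the coefficients
  \<open>c a\<close> of \<open>x ^ a * y ^ (m - a)\<close>; with integer indices no boundary cases arise.
\<close>

definition coeff_Z :: "real \<Rightarrow> int \<Rightarrow> (int \<Rightarrow> real) \<Rightarrow> int \<Rightarrow> real" where
  "coeff_Z t m c a = (a + 1) * c (a + 1) - t * (m - a + 1) * c (a - 1)"

definition coeff_Zbar :: "real \<Rightarrow> int \<Rightarrow> (int \<Rightarrow> real) \<Rightarrow> int \<Rightarrow> real" where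
  "coeff_Zbar t m c a = t * (a + 1) * c (a + 1) - (m - a + 1) * c (a - 1)"

definition coeff_paneitz :: "real \<Rightarrow> int \<Rightarrow> (int \<Rightarrow> real) \<Rightarrow> int \<Rightarrow> real" where
  "coeff_paneitz t m c a =
     coeff_Zbar t m (coeff_Z t m (coeff_Z t m (coeff_Zbar t m c))) a
     + 4 * t * coeff_Zbar t m (coeff_Zbar t m c) a"

definition hom_coeffs :: "int \<Rightarrow> (int \<Rightarrow> real) set" where
  "hom_coeffs m = {c. \<forall>a. a \<notin> {0..m} \<longrightarrow> c a = 0}"

text \<open>Up to a factor, the squared norm of \<open>z ^ a * cnj w ^ (m - a)\<close> in \<open>L\<^sup>2\<close> of the sphere.\<close>

definition factorial_weight :: "int \<Rightarrow> int \<Rightarrow> real" where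
  "factorial_weight m a = fact (nat a) * fact (nat (m - a))"

definition coeff_inner :: "int \<Rightarrow> (int \<Rightarrow> real) \<Rightarrow> (int \<Rightarrow> real) \<Rightarrow> real" where
  "coeff_inner m c d = (\<Sum>a\<in>{0..m}. factorial_weight m a * c a * d a)"

lemma factorial_weight_pos: "0 < factorial_weight m a"
  by (simp add: factorial_weight_def)

lemma coeff_Z_lin:
  "coeff_Z t m (\<lambda>i. a * c i + b * d i) = (\<lambda>i. a * coeff_Z t m c i + b * coeff_Z t m d i)"
  by (rule ext) (simp add: coeff_Z_def algebra_simps)

lemma coeff_Zbar_lin:
  "coeff_Zbar t m (\<lambda>i. a * c i + b * d i) = (\<lambda>i. a * coeff_Zbar t m c i + b * coeff_Zbar t m d i)"
  by (rule ext) (simp add: coeff_Zbar_def algebra_simps)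

lemma coeff_paneitz_lin:
  "coeff_paneitz t m (\<lambda>i. a * c i + b * d i)
     = (\<lambda>i. a * coeff_paneitz t m c i + b * coeff_paneitz t m d i)"
  unfolding coeff_paneitz_def coeff_Z_lin coeff_Zbar_lin
  by (rule ext) (simp add: algebra_simps)

lemma coeff_Z_hom: "c \<in> hom_coeffs m \<Longrightarrow> coeff_Z t m c \<in> hom_coeffs m"
  unfolding hom_coeffs_def mem_Collect_eq
proof (intro allI impI)
  fix a assume c: "\<forall>a. a \<notin> {0..m} \<longrightarrow> c a = 0" and a: "a \<notin> {0..m}"
  \<comment> \<open>Only -1 and m + 1 can have a neighbour inside the range, and there the factor a
    + 1 or m - a + 1 in front of it vanishes.\<close>
  consider "a = - 1" | "a = m + 1" | "a + 1 \<notin> {0..m}" "a - 1 \<notin> {0..m}" using a by fastforce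
  then show "coeff_Z t m c a = 0"
    unfolding coeff_Z_def using c by cases auto
qed

lemma coeff_Zbar_hom: "c \<in> hom_coeffs m \<Longrightarrow> coeff_Zbar t m c \<in> hom_coeffs m"
  unfolding hom_coeffs_def mem_Collect_eq
proof (intro allI impI)
  fix a assume c: "\<forall>a. a \<notin> {0..m} \<longrightarrow> c a = 0" and a: "a \<notin> {0..m}"
  consider "a = - 1" | "a = m + 1" | "a + 1 \<notin> {0..m}" "a - 1 \<notin> {0..m}" using a by fastforce
  then show "coeff_Zbar t m c a = 0"
    unfolding coeff_Zbar_def using c by cases auto
qed

lemma coeff_paneitz_hom:
  assumes "c \<in> hom_coeffs m"
  shows "coeff_paneitz t m c \<in> hom_coeffs m"
proof -
  have "coeff_Zbar t m (coeff_Z t m (coeff_Z t m (coeff_Zbar t m c))) \<in> hom_coeffs m"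
    "coeff_Zbar t m (coeff_Zbar t m c) \<in> hom_coeffs m"
    by (intro coeff_Zbar_hom coeff_Z_hom assms)+
  then show ?thesis by (simp add: hom_coeffs_def coeff_paneitz_def)
qed

section \<open>Symmetry with respect to the factorial weights\<close>

lemma coeff_inner_commute: "coeff_inner m c d = coeff_inner m d c"
  by (simp add: coeff_inner_def mult_ac)

lemma coeff_inner_lin_left:
  "coeff_inner m (\<lambda>i. a * c i + b * d i) e = a * coeff_inner m c e + b * coeff_inner m d e"
  by (simp add: coeff_inner_def sum_distrib_left sum.distrib algebra_simps)

lemma factorial_weight_step:
  assumes "0 \<le> a" "a < m"
  shows "factorial_weight m a * (a + 1) = factorial_weight m (a + 1) * (m - a)"
proof -
  have "nat (a + 1) = Suc (nat a)" "nat (m - a) = Suc (nat (m - (a + 1)))"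
    using assms by linarith+
  then show ?thesis using assms by (simp add: factorial_weight_def algebra_simps)
qed

text \<open>The operators y \<partial>_x and x \<partial>_y are adjoint: an index shift trades the
  weight at a for the one at a + 1 by \<open>factorial_weight_step\<close>.\<close>

lemma coeff_inner_raise:
  fixes c d :: "int \<Rightarrow> real"
  assumes "c \<in> hom_coeffs m" "d \<in> hom_coeffs m"
  shows "coeff_inner m (\<lambda>a. real_of_int (a + 1) * c (a + 1)) d = coeff_inner m c (\<lambda>a. real_of_int (m - a + 1) * d (a - 1))"
proof (cases "0 \<le> m")
  case True
  have "coeff_inner m (\<lambda>a. real_of_int (a + 1) * c (a + 1)) d = (\<Sum>a\<in>{0..<m}. factorial_weight m a * ((a + 1) * c (a + 1)) * d a)"
    unfolding coeff_inner_def
    by (rule sum.mono_neutral_right) (use assms in \<open>auto simp: hom_coeffs_def\<close>)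
  also have "\<dots> = (\<Sum>a\<in>{0..<m}. factorial_weight m (a + 1) * c (a + 1) * ((m - a) * d a))"
    by (rule sum.cong) (use factorial_weight_step[of _ m] in \<open>auto simp: mult_ac\<close>)
  also have "\<dots> = (\<Sum>a\<in>{1..m}. factorial_weight m a * c a * ((m - a + 1) * d (a - 1)))"
    by (rule sum.reindex_bij_witness[of _ "\<lambda>a. a - 1" "\<lambda>a. a + 1"]) auto
  also have "\<dots> = coeff_inner m c (\<lambda>a. real_of_int (m - a + 1) * d (a - 1))"
    unfolding coeff_inner_def
    by (rule sum.mono_neutral_left) (use assms in \<open>auto simp: hom_coeffs_def\<close>)
  finally show ?thesis .
qed (simp add: coeff_inner_def)

lemma coeff_inner_Zbar:
  assumes "c \<in> hom_coeffs m" "d \<in> hom_coeffs m"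
  shows "coeff_inner m (coeff_Zbar t m c) d = - coeff_inner m c (coeff_Z t m d)"
proof -
  let ?c = "\<lambda>a. real_of_int (a + 1) * c (a + 1)" and ?d = "\<lambda>a. real_of_int (a + 1) * d (a + 1)"
  let ?c' = "\<lambda>a. real_of_int (m - a + 1) * c (a - 1)" and ?d' = "\<lambda>a. real_of_int (m - a + 1) * d (a - 1)"
  have "coeff_inner m (coeff_Zbar t m c) d = t * coeff_inner m ?c d + (- 1) * coeff_inner m ?c' d"
    unfolding coeff_inner_lin_left[symmetric] by (simp add: coeff_Zbar_def[abs_def] mult.assoc)
  also have "\<dots> = t * coeff_inner m ?d' c + (- 1) * coeff_inner m ?d c"
    by (simp only: trans[OF coeff_inner_raise[OF assms] coeff_inner_commute]
          trans[OF coeff_inner_commute coeff_inner_raise[OF assms(2,1), symmetric]])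
  also have "\<dots> = - coeff_inner m (coeff_Z t m d) c"
    unfolding coeff_inner_lin_left[symmetric]
    by (simp add: coeff_Z_def[abs_def] coeff_inner_def flip: sum_negf) (simp add: algebra_simps)
  finally show ?thesis by (simp add: coeff_inner_commute)
qed

lemma coeff_inner_Z:
  assumes "c \<in> hom_coeffs m" "d \<in> hom_coeffs m"
  shows "coeff_inner m (coeff_Z t m c) d = - coeff_inner m c (coeff_Zbar t m d)"
  using coeff_inner_Zbar[OF assms(2,1), of t] by (simp add: coeff_inner_commute)

text \<open>Since Z and -Z' are adjoint, the adjoint of Z' (Z^2 + 4 t) Z' is Z (Z'^2 + 4 t) Z. That
  both agree is the symmetry of the operator.\<close>

lemma coeff_paneitz_alt:
  "coeff_paneitz t m c a =
     coeff_Z t m (coeff_Zbar t m (coeff_Zbar t m (coeff_Z t m c))) a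
     + 4 * t * coeff_Z t m (coeff_Z t m c) a"
  unfolding coeff_paneitz_def coeff_Z_def coeff_Zbar_def by (simp add: algebra_simps)

lemma coeff_inner_paneitz:
  assumes "c \<in> hom_coeffs m" "d \<in> hom_coeffs m"
  shows "coeff_inner m (coeff_paneitz t m c) d = coeff_inner m c (coeff_paneitz t m d)"
proof -
  note h = coeff_Z_hom coeff_Zbar_hom assms
  let ?Z = "coeff_Z t m" and ?W = "coeff_Zbar t m"
  have "coeff_inner m (coeff_paneitz t m c) d
      = 1 * coeff_inner m (?W (?Z (?Z (?W c)))) d + 4 * t * coeff_inner m (?W (?W c)) d"
    unfolding coeff_inner_lin_left[symmetric] by (simp add: coeff_paneitz_def[abs_def])
  also have "\<dots> = 1 * coeff_inner m (?Z (?W (?W (?Z d)))) c + 4 * t * coeff_inner m (?Z (?Z d)) c"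
    by (simp add: coeff_inner_Z coeff_inner_Zbar h coeff_inner_commute[of m c])
  also have "\<dots> = coeff_inner m (coeff_paneitz t m d) c"
    unfolding coeff_inner_lin_left[symmetric] by (simp add: coeff_paneitz_alt[abs_def])
  finally show ?thesis by (simp add: coeff_inner_commute)
qed

section \<open>Test vectors\<close>

context
  fixes t :: real and K :: nat
begin

abbreviation "odd_deg \<equiv> 2 * int K + 1"

definition half_binom :: "nat \<Rightarrow> real" where
  "half_binom k = (real (2 * K + 1) / 2) gchoose k"

text \<open>The solution of the homogeneous form of the recursion for \<open>testvec_numer\<close>.\<close>

primrec homogeneous_coeff :: "nat \<Rightarrow> real" where
  "homogeneous_coeff 0 = 1"
| "homogeneous_coeff (Suc k) = homogeneous_coeff k * (2 * real K - 2 * real k) / (2 * real k + 3)"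

text \<open>Row 2 k + 2 of Z' u = \<open>kernel_coeff\<close> is a recursion for the odd
  coefficients of u. Writing the coefficient at 2 k + 1 as a numerator over t^(k+1) moves all powers
  of t into the inhomogeneous term; row 0 gives the initial value.\<close>

primrec testvec_numer :: "nat \<Rightarrow> real" where
  "testvec_numer 0 = 2 * real K + 1"
| "testvec_numer (Suc k) = (t ^ (2 * k + 2) * half_binom (Suc k) * (2 * real K - 4 * real k - 3)
     + (2 * real K - 2 * real k) * testvec_numer k) / (2 * real k + 3)"

text \<open>
  With \<open>x = z\<close> and \<open>y = cnj w\<close>, the function \<open>(y\<^sup>2 + t x\<^sup>2) powr (odd_deg / 2 - 1) * (y\<^sup>2 - t x\<^sup>2)\<close> is
  annihilated by \<open>Z\<^sup>2 + 4 t\<close>. Up to a factor, \<open>kernel_coeff\<close> is the truncation at degree \<open>odd_deg\<close> of its expansion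
  in powers of \<open>x / y\<close>; the defect \<open>kernel_defect\<close> caused by the truncation is of order \<open>t ^ Suc K\<close>.
\<close>

definition kernel_coeff :: "int \<Rightarrow> real" where
  "kernel_coeff a = (if even a \<and> 0 \<le> a \<and> a \<le> odd_deg
     then t ^ nat (a div 2) * half_binom (nat (a div 2)) * (2 * real K + 1 - 4 * real (nat (a div 2)))
     else 0)"

text \<open>The solution of \<open>coeff_Zbar u = kernel_coeff\<close>, obtained by forward substitution.\<close>

definition testvec :: "int \<Rightarrow> real" where
  "testvec a = (if odd a \<and> 0 \<le> a \<and> a \<le> odd_deg
     then testvec_numer (nat (a div 2)) / t ^ Suc (nat (a div 2)) else 0)"

section \<open>Growth of the sequences in the recursion\<close>

lemma half_binom_Suc:
  "half_binom (Suc k) = half_binom k * (2 * real K + 1 - 2 * real k) / (2 * real k + 2)"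
  using gbinomial_mult_1[of "real (2 * K + 1) / 2" k]
  unfolding half_binom_def by (simp add: field_simps)

lemma half_binom_0: "half_binom 0 = 1"
  by (simp add: half_binom_def)

lemma half_binom_pos: "k \<le> Suc K \<Longrightarrow> 0 < half_binom k"
  by (induction k) (simp_all add: half_binom_0 half_binom_Suc)

lemma homogeneous_coeff_pos: "k \<le> K \<Longrightarrow> 0 < homogeneous_coeff k"
  by (induction k) simp_all

text \<open>With x = 2 K - 2 k, the growth ratios of the two sequences differ by (x + 1) / x times
  (2 k + 3) / (2 k + 2). The first part is absorbed by the extra factor on the left, which drops
  from x + 2 to x, the second by k + 1 growing to k + 2 on the right.\<close>

lemma half_binom_le_aux:
  "k \<le> K \<Longrightarrow> half_binom k * (2 * real K + 2 - 2 * real k)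
     \<le> (real k + 1) * (2 * real K + 2) * homogeneous_coeff k"
proof (induction k)
  case (Suc k)
  have k: "real k + 1 \<le> real K" using Suc.prems by simp
  define x b h where "x = 2 * real K - 2 * real k" and "b = half_binom k" and "h = homogeneous_coeff k"
  have x: "2 \<le> x" using k by (simp add: x_def)
  have b: "0 < b" using half_binom_pos[of k] Suc.prems by (simp add: b_def)
  have h: "b * (x + 2) \<le> (real k + 1) * (2 * real K + 2) * h"
    using Suc by (simp add: x_def b_def h_def algebra_simps)
  have "b * (x + 1) / (2 * real k + 2) * x \<le> b * (x + 2) / (real k + 1) * (x * ((real k + 2) / (2 * real k + 3)))"
  proof -
    have "1 / (2 * real k + 2) = 1 / (real k + 1) * (1 / 2)"
      by (simp add: field_simps)
    also have "\<dots> \<le> 1 / (real k + 1) * ((real k + 2) / (2 * real k + 3))"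
      by (intro mult_left_mono) (auto simp: field_simps)
    finally have "1 / (2 * real k + 2) \<le> 1 / (real k + 1) * ((real k + 2) / (2 * real k + 3))" .
    then have "(b * (x + 1) * x) * (1 / (2 * real k + 2))
        \<le> (b * (x + 2) * x) * (1 / (real k + 1) * ((real k + 2) / (2 * real k + 3)))"
      using b x by (intro mult_mono mult_right_mono mult_left_mono) auto
    then show ?thesis by (simp add: mult_ac)
  qed
  also have "\<dots> \<le> ((2 * real K + 2) * h) * (x * ((real k + 2) / (2 * real k + 3)))"
    using h x by (intro mult_right_mono) (auto simp: field_simps)
  finally show ?case unfolding half_binom_Suc homogeneous_coeff.simps
    by (simp add: x_def b_def h_def algebra_simps)
qed (simp add: half_binom_0)

lemma half_binom_le:
  assumes "k \<le> K"
  shows "half_binom k \<le> (real k + 1) * (2 * real K + 2) * homogeneous_coeff k"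
proof -
  have "half_binom k * 1 \<le> half_binom k * (2 * real K + 2 - 2 * real k)"
    using half_binom_pos[of k] assms by (intro mult_left_mono) auto
  then show ?thesis using half_binom_le_aux[OF assms] by simp
qed

text \<open>Without the inhomogeneous term the recursion gives (2 K + 1)
  \<open>homogeneous_coeff k\<close>. That term is nonnegative while 4 k + 3 \<le> 2 K; afterwards 2
  k + 2 \<ge> K + 1, so it is small, and by \<open>half_binom_le\<close> each step loses at most a
  fixed multiple of the homogeneous solution.\<close>

lemma testvec_numer_ge:
  assumes "\<bar>t\<bar> < 1" "k \<le> K"
  shows "homogeneous_coeff k * (2 * real K + 1 - real k * ((2 * real K + 2) * (2 * real K + 1) * \<bar>t\<bar> ^ Suc K))
    \<le> testvec_numer k"
  using assms(2)
proof (induction k)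
  case (Suc k)
  define h b T where "h = homogeneous_coeff (Suc k)" and "b = half_binom (Suc k)"
    and "T = \<bar>t\<bar> ^ Suc K"
  define D where "D = (2 * real K + 2) * (2 * real K + 1) * T"
  have h: "0 < h" using homogeneous_coeff_pos[OF Suc.prems] by (simp add: h_def)
  have b: "0 < b" using half_binom_pos[of "Suc k"] Suc.prems by (simp add: b_def)
  have bh: "b \<le> (real k + 2) * (2 * real K + 2) * h"
    using half_binom_le[OF Suc.prems] by (simp add: b_def h_def add_ac)
  have T: "0 \<le> T" by (simp add: T_def)
  have te: "t ^ (2 * k + 2) = \<bar>t\<bar> ^ (2 * k + 2)" by (simp add: power_even_abs)
  have tnn: "0 \<le> t ^ (2 * k + 2)" unfolding te by (rule zero_le_power) simp
  have "- (D * h * (2 * real k + 3)) \<le> t ^ (2 * k + 2) * b * (2 * real K - 4 * real k - 3)"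
  proof (cases "4 * k + 3 \<le> 2 * K")
    case True
    then have "0 \<le> t ^ (2 * k + 2) * b * (2 * real K - 4 * real k - 3)"
      using b tnn by (intro mult_nonneg_nonneg) auto
    moreover have "0 \<le> D * h * (2 * real k + 3)" using h T by (simp add: D_def)
    ultimately show ?thesis by linarith
  next
    case False
    have "t ^ (2 * k + 2) \<le> T"
      unfolding te T_def using False assms(1) by (intro power_decreasing) auto
    then have "t ^ (2 * k + 2) * b * (4 * real k + 3 - 2 * real K)
        \<le> T * ((real k + 2) * (2 * real K + 2) * h) * (2 * real K + 1)"
      using bh b False Suc.prems T h by (intro mult_mono) (auto simp: te)
    also have "\<dots> = D * h * (real k + 2)" by (simp add: D_def)
    also have "\<dots> \<le> D * h * (2 * real k + 3)" using h T by (intro mult_left_mono) (auto simp: D_def)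
    finally show ?thesis by (simp add: algebra_simps)
  qed
  moreover have "(2 * real K - 2 * real k) * (homogeneous_coeff k * (2 * real K + 1 - real k * D))
      \<le> (2 * real K - 2 * real k) * testvec_numer k"
    using Suc by (intro mult_left_mono) (auto simp: D_def T_def)
  moreover have "(2 * real K - 2 * real k) * (homogeneous_coeff k * (2 * real K + 1 - real k * D))
      = (2 * real k + 3) * (h * (2 * real K + 1 - real k * D))"
    by (simp add: h_def field_simps)
  ultimately have "(2 * real k + 3) * (h * (2 * real K + 1 - real (Suc k) * D))
      \<le> t ^ (2 * k + 2) * b * (2 * real K - 4 * real k - 3) + (2 * real K - 2 * real k) * testvec_numer k"
    by (simp add: algebra_simps)
  then have "h * (2 * real K + 1 - real (Suc k) * D) \<le> testvec_numer (Suc k)"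
    unfolding testvec_numer.simps b_def[symmetric] by (subst pos_le_divide_eq) (auto simp: mult_ac)
  then show ?case by (simp only: h_def D_def T_def)
qed simp

lemma coeff_Zbar_testvec:
  assumes "t \<noteq> 0"
  shows "coeff_Zbar t odd_deg testvec = kernel_coeff"
proof
  fix a
  consider "odd a" | "a < 0" "even a" | "a > odd_deg" "even a" | k where "a = 2 * int k" "k \<le> K"
  proof (cases "odd a \<or> a < 0 \<or> a > odd_deg")
    case False
    then have "a = 2 * int (nat (a div 2))" "nat (a div 2) \<le> K" by auto
    then show ?thesis using that by blast
  qed (use that in blast)
  then show "coeff_Zbar t odd_deg testvec a = kernel_coeff a"
  proof cases
    \<comment> \<open>The row \<open>odd_deg + 1\<close> contains the top coefficient of
      \<open>testvec\<close>, but with the factor m - a + 1 = 0. Hence the system closes.\<close>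
    case 3
    then have "a = odd_deg + 1 \<or> a > odd_deg + 1" by auto
    then show ?thesis using 3 by (auto simp: coeff_Zbar_def testvec_def kernel_coeff_def)
  next
    case (4 k)
    show ?thesis
    proof (cases k)
      case 0
      then show ?thesis using 4 assms by (simp add: coeff_Zbar_def testvec_def kernel_coeff_def half_binom_0)
    next
      case (Suc j)
      have e: "(2 * int (Suc j) + 1) div 2 = int (Suc j)" "(2 * int (Suc j) - 1) div 2 = int j" by auto
      have n: "(2 * real j + 3) * testvec_numer (Suc j) = t ^ (2 * j + 2) * half_binom (Suc j) * (2 * real K - 4 * real j - 3)
     + (2 * real K - 2 * real j) * testvec_numer j" by simp
      define s where "s = t ^ Suc j"
      have s: "s \<noteq> 0" "t ^ (2 * j + 2) = s * s"
        using assms by (auto simp: s_def mult_2 simp flip: power_add)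
      have "coeff_Zbar t odd_deg testvec a
        = ((2 * real j + 3) * testvec_numer (Suc j) - (2 * real K - 2 * real j) * testvec_numer j) / s"
        using 4 Suc assms unfolding coeff_Zbar_def testvec_def 4(1) Suc e
        by (simp add: s_def field_simps nat_add_distrib del: testvec_numer.simps)
      also have "\<dots> = s * half_binom (Suc j) * (2 * real K - 4 * real j - 3)"
        unfolding n s(2) using s(1) by simp
      also have "\<dots> = kernel_coeff a"
        using 4 Suc unfolding kernel_coeff_def 4(1) Suc s_def by (simp add: nat_add_distrib)
      finally show ?thesis .
    qed
  qed (auto simp: coeff_Zbar_def testvec_def kernel_coeff_def)
qed

lemma coeff_Z_Z:
  "coeff_Z t m (coeff_Z t m c) a = (a + 1) * (a + 2) * c (a + 2)
     - t * ((a + 1) * (m - a) + (m - a + 1) * a) * c a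
     + t\<^sup>2 * (m - a + 1) * (m - a + 2) * c (a - 2)"
  by (simp add: coeff_Z_def algebra_simps power2_eq_square)

text \<open>Minus the contribution (2 K + 1) (2 K + 2) t^(K+1) \<open>half_binom (Suc K)\<close> (-2
  K - 3) of the first omitted coefficient, simplified by \<open>half_binom_Suc\<close>.\<close>

definition kernel_defect :: real where
  "kernel_defect = (2 * real K + 1) * (2 * real K + 3) * t ^ Suc K * half_binom K"

lemma kernel_coeff_even:
  "k \<le> K \<Longrightarrow> kernel_coeff (2 * int k) = t ^ k * half_binom k * (2 * real K + 1 - 4 * real k)"
  by (simp add: kernel_coeff_def)

text \<open>The full series satisfies the three-term relation in every row. Truncation shows only in
  row 2 K, which misses the coefficient at 2 K + 2; row 2 K + 2 sees the one at 2 K with factor m -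
  a + 1 = 0.\<close>

lemma coeff_Z_kernel_coeff:
  "coeff_Z t odd_deg (coeff_Z t odd_deg kernel_coeff) a + 4 * t * kernel_coeff a = (if a = 2 * int K then kernel_defect else 0)"
proof -
  consider "odd a" | "a < 0" "even a" | "a > odd_deg" "even a" | k where "a = 2 * int k" "k \<le> K"
  proof (cases "odd a \<or> a < 0 \<or> a > odd_deg")
    case False
    then have "a = 2 * int (nat (a div 2))" "nat (a div 2) \<le> K" by auto
    then show ?thesis using that by blast
  qed (use that in blast)
  then show ?thesis
  proof cases
    case 1
    then show ?thesis by (auto simp: coeff_Z_Z kernel_coeff_def)
  next
    case 2
    then have "a = - 2 \<or> a < - 2" by presburger
    then show ?thesis using 2 by (auto simp: coeff_Z_Z kernel_coeff_def)
  next
    case 3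
    then have "a = odd_deg + 1 \<or> a > odd_deg + 2" by presburger
    then show ?thesis using 3 by (auto simp: coeff_Z_Z kernel_coeff_def)
  next
    case (4 k)
    define x y where "x = real K" and "y = real k"
    define b where "b = half_binom k"
    define C where "C = (if k = K then 0 else t ^ Suc k * half_binom (Suc k) * (2 * x - 4 * y - 3))"
    have up: "kernel_coeff (a + 2) = C"
    proof (cases "k = K")
      case True
      then show ?thesis using 4 by (simp add: kernel_coeff_def C_def)
    next
      case False
      have "a + 2 = 2 * int (Suc k)" using 4 by simp
      then show ?thesis using False 4 kernel_coeff_even[of "Suc k"] by (simp only: C_def) (simp add: x_def y_def algebra_simps)
    qed
    have mid: "kernel_coeff a = t ^ k * b * (2 * x + 1 - 4 * y)"
      using 4 kernel_coeff_even[of k] by (simp add: x_def y_def b_def)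
    \<comment> \<open>The first summand is the untruncated contribution even for k = K, where the
      second one corrects for the cut.\<close>
    have upC: "(2 * y + 1) * (2 * y + 2) * C
      = (2 * y + 1) * t ^ Suc k * b * (2 * x + 1 - 2 * y) * (2 * x - 4 * y - 3)
        + (if k = K then kernel_defect else 0)"
    proof (cases "k = K")
      case True
      then show ?thesis by (simp add: C_def kernel_defect_def b_def x_def y_def algebra_simps)
    next
      case False
      have hb: "(2 * y + 2) * half_binom (Suc k) = b * (2 * x + 1 - 2 * y)"
        unfolding half_binom_Suc b_def x_def y_def by simp
      have "(2 * y + 1) * (2 * y + 2) * (t ^ Suc k * half_binom (Suc k) * (2 * x - 4 * y - 3))
        = (2 * y + 1) * t ^ Suc k * ((2 * y + 2) * half_binom (Suc k)) * (2 * x - 4 * y - 3)"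
        by (simp only: mult_ac)
      also have "\<dots> = (2 * y + 1) * t ^ Suc k * (b * (2 * x + 1 - 2 * y)) * (2 * x - 4 * y - 3)"
        unfolding hb ..
      finally show ?thesis using False by (simp add: C_def mult_ac)
    qed
    have down: "t\<^sup>2 * (2 * x + 2 - 2 * y) * (2 * x + 3 - 2 * y) * kernel_coeff (a - 2)
      = t ^ Suc k * (2 * x + 2 - 2 * y) * (2 * y) * b * (2 * x + 5 - 4 * y)"
    proof (cases k)
      case 0
      then show ?thesis using 4 by (simp add: kernel_coeff_def y_def)
    next
      case (Suc j)
      have a2: "a - 2 = 2 * int j" using 4 Suc by simp
      have bj: "(2 * x + 3 - 2 * y) * half_binom j = b * (2 * y)"
        unfolding b_def Suc half_binom_Suc x_def y_def by (simp add: field_simps)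
      have "t\<^sup>2 * (2 * x + 2 - 2 * y) * (2 * x + 3 - 2 * y) * kernel_coeff (a - 2)
        = t\<^sup>2 * t ^ j * (2 * x + 2 - 2 * y) * ((2 * x + 3 - 2 * y) * half_binom j) * (2 * x + 5 - 4 * y)"
        using 4 Suc unfolding a2 by (subst kernel_coeff_even) (simp_all add: x_def y_def mult_ac)
      also have "t\<^sup>2 * t ^ j = t ^ Suc k" by (simp add: Suc power2_eq_square)
      finally show ?thesis unfolding bj by (simp add: mult_ac)
    qed
    have "coeff_Z t odd_deg (coeff_Z t odd_deg kernel_coeff) a + 4 * t * kernel_coeff a
      = (2 * y + 1) * (2 * y + 2) * C
        - t * ((2 * y + 1) * (2 * x + 1 - 2 * y) + (2 * x + 2 - 2 * y) * (2 * y) - 4) * kernel_coeff a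
        + t\<^sup>2 * (2 * x + 2 - 2 * y) * (2 * x + 3 - 2 * y) * kernel_coeff (a - 2)"
      unfolding coeff_Z_Z up using 4 by (simp add: x_def y_def algebra_simps)
    also have "\<dots> = (if k = K then kernel_defect else 0)"
      unfolding upC down mid by (simp add: algebra_simps)
    finally show ?thesis using 4 by simp
  qed
qed

section \<open>The quadratic form at the test vector\<close>

lemma testvec_hom: "testvec \<in> hom_coeffs odd_deg"
  by (auto simp: hom_coeffs_def testvec_def)

lemma coeff_paneitz_testvec:
  assumes "t \<noteq> 0"
  shows "coeff_paneitz t odd_deg testvec
    = (\<lambda>a. kernel_defect * coeff_Zbar t odd_deg (\<lambda>b. if b = 2 * int K then 1 else 0) a)"
proof
  fix a
  have "coeff_paneitz t odd_deg testvec a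
    = coeff_Zbar t odd_deg (\<lambda>b. 1 * coeff_Z t odd_deg (coeff_Z t odd_deg kernel_coeff) b + 4 * t * kernel_coeff b) a"
    unfolding coeff_Zbar_lin coeff_paneitz_def coeff_Zbar_testvec[OF assms] by simp
  also have "\<dots> = kernel_defect * coeff_Zbar t odd_deg (\<lambda>b. if b = 2 * int K then 1 else 0) a"
  proof (cases "a - 1 = 2 * int K")
    case True
    then have a: "a = 2 * int K + 1" by simp
    show ?thesis unfolding a by (simp only: mult_1 coeff_Z_kernel_coeff) (simp add: coeff_Zbar_def)
  next
    case False
    then show ?thesis by (simp only: mult_1 coeff_Z_kernel_coeff) (simp add: coeff_Zbar_def)
  qed
  finally show "coeff_paneitz t odd_deg testvec a
    = kernel_defect * coeff_Zbar t odd_deg (\<lambda>b. if b = 2 * int K then 1 else 0) a" .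
qed

text \<open>P u is the defect times Z' of a unit vector at 2 K. Moving Z' to the other side, the
  pairing of P u with c only reads off the coefficient of Z c at 2 K. For c = u its leading part has
  t^(K+1) in the denominator, which the defect cancels; for c = P u a second defect appears.\<close>

lemma coeff_inner_paneitz_testvec:
  fixes \<epsilon> :: real
  assumes "t \<noteq> 0"
  defines "m \<equiv> 2 * real K + 1"
  shows "coeff_inner odd_deg (coeff_paneitz t odd_deg testvec) (coeff_paneitz t odd_deg testvec)
    + \<epsilon> * coeff_inner odd_deg (coeff_paneitz t odd_deg testvec) testvec
    = factorial_weight odd_deg (2 * int K) * m * (m + 2) * half_binom K *
      ((t\<^sup>2) ^ Suc K * half_binom K * (m * (m + 2) * (m + 2 * t\<^sup>2 * (m - 1)) + \<epsilon> * (m - 2))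
       - \<epsilon> * m * (1 - t\<^sup>2) * testvec_numer K)"
proof -
  define \<delta> :: "int \<Rightarrow> real" where "\<delta> = (\<lambda>b. if b = 2 * int K then 1 else 0)"
  let ?Z = "coeff_Z t odd_deg" and ?W = "coeff_Zbar t odd_deg" and ?P = "coeff_paneitz t odd_deg testvec"
  have \<delta>h: "\<delta> \<in> hom_coeffs odd_deg" by (auto simp: hom_coeffs_def \<delta>_def)
  have w\<delta>: "coeff_inner odd_deg \<delta> c = factorial_weight odd_deg (2 * int K) * c (2 * int K)" for c
    unfolding coeff_inner_def \<delta>_def by (subst sum.remove[of _ "2 * int K"]) auto
  have P: "?P = (\<lambda>a. kernel_defect * ?W \<delta> a + 0 * ?W \<delta> a)"
    unfolding coeff_paneitz_testvec[OF assms(1)] \<delta>_def by simp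
  have Pc: "coeff_inner odd_deg ?P c = - kernel_defect * factorial_weight odd_deg (2 * int K) * ?Z c (2 * int K)"
    if "c \<in> hom_coeffs odd_deg" for c
    unfolding P coeff_inner_lin_left using coeff_inner_Zbar[OF \<delta>h that, of t] by (simp add: w\<delta>)
  have ZP: "?Z ?P (2 * int K) = - kernel_defect * (m + 2 * t\<^sup>2 * (m - 1))"
    unfolding P coeff_Z_lin
    by (simp add: coeff_Z_def coeff_Zbar_def \<delta>_def m_def algebra_simps power2_eq_square)
  \<comment> \<open>Row 2 K of Z' u = \<open>kernel_coeff\<close> eliminates the coefficient of u at
    2 K - 1, leaving only the top one.\<close>
  have "?W testvec (2 * int K) = t ^ K * half_binom K * (1 - 2 * real K)"
    unfolding coeff_Zbar_testvec[OF assms(1)] by (subst kernel_coeff_even) auto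
  moreover have "testvec (2 * int K + 1) = testvec_numer K / t ^ Suc K"
    by (simp add: testvec_def)
  moreover define q where "q = testvec_numer K / t ^ Suc K"
  ultimately have "t * m * q - 2 * testvec (2 * int K - 1) = t ^ K * half_binom K * (1 - 2 * real K)"
    by (simp add: coeff_Zbar_def m_def)
  then have "2 * testvec (2 * int K - 1) = t * m * q + t ^ K * half_binom K * (m - 2)"
    by (simp add: m_def algebra_simps)
  moreover have "?Z testvec (2 * int K) = m * q - t * (2 * testvec (2 * int K - 1))"
    by (simp add: coeff_Z_def testvec_def m_def q_def)
  ultimately have "?Z testvec (2 * int K) = m * q - t * (t * m * q + t ^ K * half_binom K * (m - 2))"
    by simp
  then have Zu: "?Z testvec (2 * int K)
      = m * (1 - t\<^sup>2) * (testvec_numer K / t ^ Suc K) - t ^ Suc K * half_binom K * (m - 2)"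
    by (fold q_def) (simp add: algebra_simps power2_eq_square)
  have k: "kernel_defect = m * (m + 2) * t ^ Suc K * half_binom K" by (simp add: kernel_defect_def m_def)
  have kq: "kernel_defect * (testvec_numer K / t ^ Suc K) = m * (m + 2) * half_binom K * testvec_numer K"
    using assms(1) by (simp add: k)
  have kk: "t ^ Suc K * t ^ Suc K = (t\<^sup>2) ^ Suc K" by (simp only: power2_eq_square power_mult_distrib)
  have "coeff_inner odd_deg ?P ?P + \<epsilon> * coeff_inner odd_deg ?P testvec = factorial_weight odd_deg (2 * int K) *
    (kernel_defect * kernel_defect * (m + 2 * t\<^sup>2 * (m - 1))
     - \<epsilon> * (m * (1 - t\<^sup>2) * (kernel_defect * (testvec_numer K / t ^ Suc K)) - kernel_defect * t ^ Suc K * half_binom K * (m - 2)))"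
    unfolding Pc[OF coeff_paneitz_hom[OF testvec_hom]] Pc[OF testvec_hom] ZP Zu
    by (simp only: algebra_simps)
  also have "\<dots> = factorial_weight odd_deg (2 * int K) *
    (m * (m + 2) * half_binom K * (m * (m + 2) * half_binom K) * (t ^ Suc K * t ^ Suc K) * (m + 2 * t\<^sup>2 * (m - 1))
     - \<epsilon> * (m * (1 - t\<^sup>2) * (m * (m + 2) * half_binom K * testvec_numer K)
       - m * (m + 2) * half_binom K * (t ^ Suc K * t ^ Suc K) * half_binom K * (m - 2)))"
    unfolding kq by (simp only: k mult_ac)
  finally show ?thesis unfolding kk by (simp add: algebra_simps)
qed

end

text \<open>Both \<open>testvec_numer\<close> (from below) and \<open>half_binom\<close> (from
  above) are compared at K with \<open>homogeneous_coeff\<close>. This common factor cancels, and a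
  polynomial in K times \<bar>t\<bar>^(K+1) is left to be beaten by a positive constant.\<close>

lemma coeff_paneitz_testvec_negative:
  fixes t \<epsilon> :: real
  assumes t: "0 < \<bar>t\<bar>" "\<bar>t\<bar> < 1" and \<epsilon>: "0 < \<epsilon>"
  shows "\<exists>K. coeff_inner (2 * int K + 1) (coeff_paneitz t (2 * int K + 1) (testvec t K)) (coeff_paneitz t (2 * int K + 1) (testvec t K))
    + \<epsilon> * coeff_inner (2 * int K + 1) (coeff_paneitz t (2 * int K + 1) (testvec t K)) (testvec t K) < 0"
proof -
  define r where "r = \<bar>t\<bar>"
  have r: "0 < r" "r < 1" using t by (auto simp: r_def)
  have t2: "0 < 1 - t\<^sup>2" using t by (simp add: abs_square_less_1)
  \<comment> \<open>The first limit makes the loss in \<open>testvec_numer_ge\<close> at most half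
    of the main term; the second is what the final comparison needs.\<close>
  have "((\<lambda>K. real K * (2 * real K + 2) * r ^ Suc K) \<longlongrightarrow> 0) sequentially"
    using r by real_asymp
  then have ev1: "\<forall>\<^sub>F K in sequentially. real K * (2 * real K + 2) * r ^ Suc K < 1 / 2"
    by (rule order_tendstoD) simp
  have "((\<lambda>K. (2 * real K + 2)\<^sup>2 * (3 * (2 * real K + 1) * (2 * real K + 3) + \<epsilon>) * r ^ Suc K) \<longlongrightarrow> 0) sequentially"
    using r by real_asymp
  then have ev2: "\<forall>\<^sub>F K in sequentially.
      (2 * real K + 2)\<^sup>2 * (3 * (2 * real K + 1) * (2 * real K + 3) + \<epsilon>) * r ^ Suc K < \<epsilon> * (1 - t\<^sup>2)"
    by (rule order_tendstoD) (use \<epsilon> t2 in simp)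
  obtain K where K1: "real K * (2 * real K + 2) * r ^ Suc K < 1 / 2"
    and K2: "(2 * real K + 2)\<^sup>2 * (3 * (2 * real K + 1) * (2 * real K + 3) + \<epsilon>) * r ^ Suc K < \<epsilon> * (1 - t\<^sup>2)"
    using eventually_happens'[OF sequentially_bot eventually_conj[OF ev1 ev2]] by blast
  define m h b T where "m = 2 * real K + 1" and "h = homogeneous_coeff K K" and "b = half_binom K K"
    and "T = (t\<^sup>2) ^ Suc K"
  have m: "1 \<le> m" by (simp add: m_def)
  have h: "0 < h" by (simp add: h_def homogeneous_coeff_pos)
  have b: "0 < b" by (simp add: b_def half_binom_pos)
  have bh: "b \<le> (m + 1)\<^sup>2 / 2 * h"
    using half_binom_le[of K K] unfolding b_def h_def m_def by (simp add: field_simps power2_eq_square)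
  \<comment> \<open>Half of the exponent is given away; one power r^(K+1) still beats every
    polynomial.\<close>
  have T: "0 \<le> T" "T \<le> r ^ Suc K"
  proof -
    have "t\<^sup>2 = r * r" by (simp add: r_def power2_eq_square)
    also have "\<dots> \<le> r * 1" using r by (intro mult_left_mono) auto
    finally show "T \<le> r ^ Suc K" unfolding T_def by (intro power_mono) auto
  qed (simp add: T_def)
  have n: "h * (m / 2) \<le> testvec_numer t K K"
  proof -
    have "m * (real K * (2 * real K + 2) * r ^ Suc K) \<le> m * (1 / 2)"
      using K1 m by (intro mult_left_mono) auto
    then have "h * (m / 2) \<le> h * (m - m * (real K * (2 * real K + 2) * r ^ Suc K))"
      using h by (intro mult_left_mono) auto
    also have "\<dots> = h * (2 * real K + 1 - real K * ((2 * real K + 2) * (2 * real K + 1) * \<bar>t\<bar> ^ Suc K))"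
      by (simp only: m_def r_def mult_ac)
    also have "\<dots> \<le> testvec_numer t K K" unfolding h_def using testvec_numer_ge[OF t(2), of K K] by simp
    finally show ?thesis .
  qed
  define S where "S = 3 * m * (m + 2) + \<epsilon>"
  have S: "0 \<le> S" using m \<epsilon> by (simp add: S_def)
  have "m * (m + 2) * (m + 2 * t\<^sup>2 * (m - 1)) \<le> m * (m + 2) * (m + 2 * 1 * m)"
    using m t2 by (intro mult_left_mono add_left_mono mult_mono) auto
  moreover have "\<epsilon> * (m - 2) \<le> \<epsilon> * m" using \<epsilon> by simp
  ultimately have le: "m * (m + 2) * (m + 2 * t\<^sup>2 * (m - 1)) + \<epsilon> * (m - 2) \<le> m * S"
    by (simp add: S_def algebra_simps)
  have "T * b * (m * (m + 2) * (m + 2 * t\<^sup>2 * (m - 1)) + \<epsilon> * (m - 2)) \<le> T * b * (m * S)"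
    using T b le by (intro mult_left_mono) auto
  also have "\<dots> \<le> r ^ Suc K * ((m + 1)\<^sup>2 / 2 * h) * (m * S)"
    using T bh S m b h by (intro mult_right_mono mult_mono) auto
  also have "\<dots> = ((m + 1)\<^sup>2 * S * r ^ Suc K) * (h * m / 2)" by simp
  also have "\<dots> < (\<epsilon> * (1 - t\<^sup>2)) * (h * m / 2)"
    using K2 h m by (intro mult_strict_right_mono) (auto simp: S_def m_def add_ac)
  also have "\<dots> \<le> (\<epsilon> * (1 - t\<^sup>2)) * testvec_numer t K K"
    using n \<epsilon> t2 by (intro mult_left_mono) auto
  also have "\<dots> \<le> (\<epsilon> * (1 - t\<^sup>2)) * testvec_numer t K K * m"
  proof -
    have "0 \<le> testvec_numer t K K" using n h m by (smt (verit) mult_nonneg_nonneg divide_nonneg_nonneg)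
    then have "0 \<le> (\<epsilon> * (1 - t\<^sup>2)) * testvec_numer t K K" using \<epsilon> t2 by simp
    then show ?thesis using m by (simp add: mult_le_cancel_left1)
  qed
  finally have neg: "T * b * (m * (m + 2) * (m + 2 * t\<^sup>2 * (m - 1)) + \<epsilon> * (m - 2))
      - \<epsilon> * m * (1 - t\<^sup>2) * testvec_numer t K K < 0" by (simp add: mult_ac)
  have "t \<noteq> 0" using t by auto
  then show ?thesis
    using mult_pos_neg[OF _ neg, of "factorial_weight (2 * int K + 1) (2 * int K) * m * (m + 2) * b"] m b factorial_weight_pos
    by (intro exI[of _ K]) (simp add: coeff_inner_paneitz_testvec m_def b_def T_def)
qed

lemma coeff_paneitz_eigenvector:
  fixes t \<epsilon> :: real
  assumes t: "0 < \<bar>t\<bar>" "\<bar>t\<bar> < 1" and \<epsilon>: "0 < \<epsilon>"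
  obtains m :: int and r :: real and c where "- \<epsilon> < r" "r < 0" "c \<in> hom_coeffs m" "c \<noteq> (\<lambda>_. 0)"
    "coeff_paneitz t m c = (\<lambda>a. r * c a)"
proof -
  obtain K where K: "coeff_inner (2 * int K + 1) (coeff_paneitz t (2 * int K + 1) (testvec t K)) (coeff_paneitz t (2 * int K + 1) (testvec t K))
    + \<epsilon> * coeff_inner (2 * int K + 1) (coeff_paneitz t (2 * int K + 1) (testvec t K)) (testvec t K) < 0"
    using coeff_paneitz_testvec_negative[OF assms] by blast
  define m where "m = 2 * int K + 1"
  have coordc: "continuous_on A (\<lambda>c::int \<Rightarrow> real. c i)" for A i
    by (rule continuous_on_product_then_coordinatewise[OF continuous_on_id])
  have "continuous_on UNIV (\<lambda>c. coeff_paneitz t m c i)" for i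
    unfolding coeff_paneitz_def coeff_Z_def coeff_Zbar_def by (intro continuous_intros coordc)
  then have "\<exists>r v. - \<epsilon> < r \<and> r < 0 \<and> v \<in> hom_coeffs m \<and> v \<noteq> (\<lambda>_. 0)
     \<and> coeff_paneitz t m v = (\<lambda>i. r * v i)"
    by (intro symmetric_eigenvalue_between[of \<epsilon> "{0..m}" "factorial_weight m" "coeff_paneitz t m" "testvec t K",
        folded coeff_inner_def hom_coeffs_def])
      (use \<epsilon> K[folded m_def] testvec_hom[of t K, folded m_def] in
        \<open>simp_all add: factorial_weight_pos coeff_paneitz_lin coeff_paneitz_hom coeff_inner_paneitz\<close>)
  then show thesis using that by blast
qed

section \<open>Pseudo-Hermitian geometry of the Rossi sphere\<close>

text \<open>A complex equation, so that 1 can be replaced by its left side in polynomial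
  identities.\<close>

lemma S3_iff: "p \<in> S3 \<longleftrightarrow> fst p * cnj (fst p) + snd p * cnj (snd p) = 1"
proof -
  have "p \<in> S3 \<longleftrightarrow> (norm p)\<^sup>2 = 1" by (simp add: abs_square_eq_1)
  also have "(norm p)\<^sup>2 = (cmod (fst p))\<^sup>2 + (cmod (snd p))\<^sup>2"
    by (cases p) (simp add: norm_Pair)
  also have "\<dots> = 1 \<longleftrightarrow> complex_of_real ((cmod (fst p))\<^sup>2 + (cmod (snd p))\<^sup>2) = 1"
    by (metis of_real_eq_iff of_real_1)
  finally show ?thesis by (simp only: of_real_add complex_norm_square)
qed

definition herm_inner :: "c2 \<Rightarrow> c2 \<Rightarrow> complex" where
  "herm_inner q v = cnj (fst q) * fst v + cnj (snd q) * snd v"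

text \<open>The one-form \<open>w dz - z dw\<close>, which is \<open>\<theta>\<^sup>1\<close> on the standard sphere.\<close>

definition theta1_std :: "c2 \<Rightarrow> c2 \<Rightarrow> complex" where
  "theta1_std q v = snd q * fst v - fst q * snd v"

lemma tangent_iff: "a \<in> tangent p \<longleftrightarrow> Re (herm_inner p a) = 0"
  by (cases p; cases a) (simp add: tangent_def herm_inner_def inner_Pair inner_complex_def)

lemma theta_S3_eq: "theta_S3 q v = of_real (Im (herm_inner q v))"
  by (cases q; cases v) (simp add: theta_S3_def herm_inner_def complex_eq_iff field_simps)

lemma herm_inner_tangent: "a \<in> tangent p \<Longrightarrow> herm_inner p a = \<i> * theta_S3 p a"
  by (simp add: theta_S3_eq tangent_iff complex_eq_iff)

text \<open>The Reeb vector \<i> p and the contact vector (cnj w, - cnj z) are orthonormal for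
  \<open>herm_inner\<close>, and a tangent vector has a real coefficient at the former. All
  identities between forms are later checked in these coordinates.\<close>

lemma tangent_decomp:
  assumes "p \<in> S3" "a \<in> tangent p"
  shows "fst a = \<i> * theta_S3 p a * fst p + theta1_std p a * cnj (snd p)"
    and "snd a = \<i> * theta_S3 p a * snd p - theta1_std p a * cnj (fst p)"
proof -
  have p: "fst p * cnj (fst p) + snd p * cnj (snd p) = 1" using assms(1) by (rule S3_iff[THEN iffD1])
  have "fst a = (fst p * cnj (fst p) + snd p * cnj (snd p)) * fst a" using p by simp
  also have "\<dots> = herm_inner p a * fst p + theta1_std p a * cnj (snd p)"
    by (simp add: herm_inner_def theta1_std_def algebra_simps)
  finally show "fst a = \<i> * theta_S3 p a * fst p + theta1_std p a * cnj (snd p)"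
    using herm_inner_tangent[OF assms(2)] by simp
  have "snd a = (fst p * cnj (fst p) + snd p * cnj (snd p)) * snd a" using p by simp
  also have "\<dots> = herm_inner p a * snd p - theta1_std p a * cnj (fst p)"
    by (simp add: herm_inner_def theta1_std_def algebra_simps)
  finally show "snd a = \<i> * theta_S3 p a * snd p - theta1_std p a * cnj (fst p)"
    using herm_inner_tangent[OF assms(2)] by simp
qed

section \<open>Derivatives on the sphere through the radial retraction\<close>

lemma has_derivative_sgn_S3:
  assumes "p \<in> S3"
  shows "(sgn has_derivative tangent_proj p) (at p)"
proof -
  have n: "norm p = 1" and p0: "p \<noteq> 0" using assms by auto
  have "((\<lambda>x. inverse (norm x) *\<^sub>R x) has_derivative tangent_proj p) (at p)"
    by (rule derivative_eq_intros has_derivative_norm | (simp add: p0; fail))+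
      (use n in \<open>auto simp: tangent_proj_def sgn_div_norm fun_eq_iff inner_commute\<close>)
  then show ?thesis by (simp add: sgn_div_norm[abs_def])
qed

lemma tangent_proj_tangent: "p \<in> S3 \<Longrightarrow> tangent_proj p a \<in> tangent p"
  by (simp add: tangent_def tangent_proj_def inner_diff_right dot_square_norm)

lemma tangent_proj_id: "a \<in> tangent p \<Longrightarrow> tangent_proj p a = a"
  by (simp add: tangent_def tangent_proj_def)

lemma has_derivative_radial:
  assumes p: "p \<in> S3" and u: "\<And>q. q \<in> S3 \<Longrightarrow> u q = g q" and g: "(g has_derivative g') (at p)"
  shows "((\<lambda>x. u (sgn x)) has_derivative (\<lambda>a. g' (tangent_proj p a))) (at p)"
proof (rule has_derivative_transform_within_open)
  have "sgn p = p" using p by (simp add: sgn_div_norm)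
  then show "((\<lambda>x. g (sgn x)) has_derivative (\<lambda>a. g' (tangent_proj p a))) (at p)"
    using has_derivative_compose[OF has_derivative_sgn_S3[OF p], of g g'] g by simp
  show "p \<in> - {0}" using p by auto
  show "g (sgn x) = u (sgn x)" if "x \<in> - {0}" for x
    using that by (intro u[symmetric]) (simp add: norm_sgn)
qed (simp add: open_Compl)

text \<open>Any differentiable function that agrees with \<open>u\<close> on the sphere may be
  differentiated instead, since the retraction has the tangential projection as derivative.\<close>

lemma sphere_deriv_eq:
  assumes "p \<in> S3" "\<And>q. q \<in> S3 \<Longrightarrow> u q = g q" "(g has_derivative g') (at p)" "a \<in> tangent p"
  shows "sphere_deriv u p a = g' a"
  unfolding sphere_deriv_def
  by (subst frechet_derivative_at[symmetric, OF has_derivative_radial[where u = u and g = g, OF assms(1-3)]])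
    (simp_all add: tangent_proj_id assms(4))

lemma ext_deriv_sphere_deriv:
  "ext_deriv \<alpha> p a b = sphere_deriv (\<lambda>q. \<alpha> q (tangent_proj q b)) p a
     - sphere_deriv (\<lambda>q. \<alpha> q (tangent_proj q a)) p b"
  by (simp add: ext_deriv_def form_ext_def sphere_deriv_def)

text \<open>The form annihilates the radial direction, so the projection in \<open>form_ext\<close>
  disappears and what remains is linear in the base point.\<close>

lemma theta1_std_proj: "theta1_std q (tangent_proj q v) = theta1_std q v"
  by (simp add: theta1_std_def tangent_proj_def algebra_simps scaleR_conv_of_real)

lemma theta_proj: "theta_S3 q (tangent_proj q v) = theta_S3 q v"
  by (simp add: theta_S3_eq herm_inner_def tangent_proj_def algebra_simps)

section \<open>Contact form and Reeb field\<close>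

lemma linear_theta: "linear (theta_S3 p)"
  by (rule linearI) (simp_all add: theta_S3_eq herm_inner_def algebra_simps scaleR_conv_of_real)

lemma ext_deriv_theta:
  assumes "p \<in> S3" "a \<in> tangent p" "b \<in> tangent p"
  shows "ext_deriv theta_S3 p a b = of_real (2 * Im (herm_inner a b))"
proof -
  have d: "((\<lambda>q. theta_S3 q v) has_derivative (\<lambda>q. theta_S3 q v)) (at p)" for v
    by (rule linear_imp_has_derivative, rule linearI)
      (simp_all add: theta_S3_eq herm_inner_def algebra_simps scaleR_conv_of_real)
  have sd: "sphere_deriv (\<lambda>q. theta_S3 q (tangent_proj q v)) p x = theta_S3 x v" if "x \<in> tangent p" for x v
    by (rule sphere_deriv_eq[OF assms(1) _ d that]) (rule theta_proj)
  show ?thesis unfolding ext_deriv_sphere_deriv sd[OF assms(2)] sd[OF assms(3)]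
    by (simp add: theta_S3_eq herm_inner_def complex_eq_iff algebra_simps)
qed

lemma reeb_theta:
  assumes "p \<in> S3"
  shows "reeb theta_S3 p = (\<i> * fst p, \<i> * snd p)"
  unfolding reeb_def
proof (rule the_equality)
  have p: "fst p * cnj (fst p) + snd p * cnj (snd p) = 1" using assms by (rule S3_iff[THEN iffD1])
  let ?T = "(\<i> * fst p, \<i> * snd p)"
  have pT: "herm_inner p ?T = \<i> * (fst p * cnj (fst p) + snd p * cnj (snd p))"
    by (simp add: herm_inner_def algebra_simps)
  have T: "?T \<in> tangent p" unfolding tangent_iff pT p by simp
  have "herm_inner ?T a = - \<i> * herm_inner p a" for a by (simp add: herm_inner_def algebra_simps)
  then show "?T \<in> tangent p \<and> theta_S3 p ?T = 1 \<and> (\<forall>a\<in>tangent p. ext_deriv theta_S3 p ?T a = 0)"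
    using T by (auto simp: ext_deriv_theta[OF assms] theta_S3_eq pT p tangent_iff)
  fix v assume v: "v \<in> tangent p \<and> theta_S3 p v = 1 \<and> (\<forall>a\<in>tangent p. ext_deriv theta_S3 p v a = 0)"
  have "Im (herm_inner v a) = 0" if "a \<in> tangent p" for a
    using v that ext_deriv_theta[OF assms, of v a] by simp
  \<comment> \<open>The vectors of the contact plane; pairing v with those for c = 1 and c = \<i>
    kills its contact component.\<close>
  moreover have "(c * cnj (snd p), - c * cnj (fst p)) \<in> tangent p" for c
    by (simp add: tangent_iff herm_inner_def)
  ultimately have "Im (herm_inner v (c * cnj (snd p), - c * cnj (fst p))) = 0" for c by blast
  moreover have "herm_inner v (c * cnj (snd p), - c * cnj (fst p)) = c * cnj (theta1_std p v)" for c
    by (simp add: herm_inner_def theta1_std_def algebra_simps)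
  ultimately have im: "Im (c * cnj (theta1_std p v)) = 0" for c by simp
  have "theta1_std p v = 0" using im[of 1] im[of \<i>] by (simp add: complex_eq_iff)
  then show "v = ?T" using tangent_decomp[OF assms, of v] v by (simp add: prod_eq_iff)
qed

section \<open>The dual coframe of the Rossi frame\<close>

lemma rossi_frame_eq:
  "rossi_frame t p =
     (((1 + t) / 2 * cnj (snd p), - (1 + t) / 2 * cnj (fst p)),
      (- \<i> * (1 - t) / 2 * cnj (snd p), \<i> * (1 - t) / 2 * cnj (fst p)))"
  by (cases p) (simp add: rossi_frame_def Z1_def conj_vec_def cscale_def d_z_def d_w_def
      complex_eq_iff field_simps)

lemma theta1_std_add: "theta1_std p (u + v) = theta1_std p u + theta1_std p v"
  by (simp add: theta1_std_def algebra_simps)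

lemma theta1_std_rossi:
  assumes "p \<in> S3"
  shows "theta1_std p (fst (cscale c (rossi_frame t p))) = (c + t * cnj c) / 2"
    and "theta1_std p (snd (cscale c (rossi_frame t p))) = - \<i> * (c - t * cnj c) / 2"
    and "theta1_std p (fst (cscale c (conj_vec (rossi_frame t p)))) = (cnj c + t * c) / 2"
    and "theta1_std p (snd (cscale c (conj_vec (rossi_frame t p)))) = \<i> * (cnj c - t * c) / 2"
proof -
  have p: "fst p * cnj (fst p) + snd p * cnj (snd p) = 1" using assms by (rule S3_iff[THEN iffD1])
  have e: "theta1_std p (k * cnj (snd p), - k * cnj (fst p)) = k" for k
  proof -
    have "theta1_std p (k * cnj (snd p), - k * cnj (fst p)) = k * (fst p * cnj (fst p) + snd p * cnj (snd p))"
      by (simp add: theta1_std_def algebra_simps)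
    then show ?thesis by (simp add: p)
  qed
  have 1: "fst (cscale c (rossi_frame t p)) = ((c + t * cnj c) / 2 * cnj (snd p), - ((c + t * cnj c) / 2) * cnj (fst p))"
    and 2: "snd (cscale c (rossi_frame t p)) = (- \<i> * (c - t * cnj c) / 2 * cnj (snd p), - (- \<i> * (c - t * cnj c) / 2) * cnj (fst p))"
    and 3: "fst (cscale c (conj_vec (rossi_frame t p))) = ((cnj c + t * c) / 2 * cnj (snd p), - ((cnj c + t * c) / 2) * cnj (fst p))"
    and 4: "snd (cscale c (conj_vec (rossi_frame t p))) = (\<i> * (cnj c - t * c) / 2 * cnj (snd p), - (\<i> * (cnj c - t * c) / 2) * cnj (fst p))"
    by (simp_all add: rossi_frame_eq cscale_def conj_vec_def complex_eq_iff field_simps)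
  show "theta1_std p (fst (cscale c (rossi_frame t p))) = (c + t * cnj c) / 2" unfolding 1 e ..
  show "theta1_std p (snd (cscale c (rossi_frame t p))) = - \<i> * (c - t * cnj c) / 2" unfolding 2 e ..
  show "theta1_std p (fst (cscale c (conj_vec (rossi_frame t p)))) = (cnj c + t * c) / 2" unfolding 3 e ..
  show "theta1_std p (snd (cscale c (conj_vec (rossi_frame t p)))) = \<i> * (cnj c - t * c) / 2" unfolding 4 e ..
qed

text \<open>The frame change Z = Z1 + t conj Z1 gives \<open>theta1_std\<close> = \<theta>1 + t conj
  \<theta>1 dually; solving with the conjugate equation yields the formula.\<close>

lemma theta1_rossi:
  assumes p: "p \<in> S3" and v: "v \<in> tangent p" and t: "\<bar>t\<bar> < 1"
  shows "theta1 theta_S3 (rossi_frame t) p v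
    = (theta1_std p v - t * cnj (theta1_std p v)) / (1 - (complex_of_real t)\<^sup>2)"
  unfolding theta1_def reeb_theta[OF p]
proof (rule the_equality)
  have t2: "t\<^sup>2 < 1" using t by (simp add: abs_square_less_1)
  then have t2c: "1 - (complex_of_real t)\<^sup>2 \<noteq> 0"
    by (metis less_irrefl of_real_1 of_real_eq_iff of_real_power right_minus_eq)
  define a where "a = theta1_std p v"
  define c where "c = (a - t * cnj a) / (1 - (complex_of_real t)\<^sup>2)"
  have "c + t * cnj c = (a - t * cnj a + t * (cnj a - t * a)) / (1 - (complex_of_real t)\<^sup>2)"
    by (simp add: c_def add_divide_distrib)
  also have "a - t * cnj a + t * (cnj a - t * a) = a * (1 - t\<^sup>2)"
    by (simp add: algebra_simps power2_eq_square)
  finally have ca: "c + t * cnj c = a" using t2c by simp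
  have "(v, 0) = cscale (theta_S3 p v) ((\<i> * fst p, \<i> * snd p), 0) + cscale c (rossi_frame t p)
      + cscale (cnj c) (conj_vec (rossi_frame t p))"
  proof -
    have "fst v = \<i> * theta_S3 p v * fst p + (c + t * cnj c) * cnj (snd p)"
      "snd v = \<i> * theta_S3 p v * snd p - (c + t * cnj c) * cnj (fst p)"
      using tangent_decomp[OF p v] by (simp_all add: ca a_def)
    then show ?thesis
      by (cases v) (simp add: rossi_frame_eq cscale_def conj_vec_def theta_S3_eq complex_eq_iff zero_prod_def field_simps)
  qed
  then show "\<exists>c0 c'. (v, 0) = cscale c0 ((\<i> * fst p, \<i> * snd p), 0)
      + cscale ((theta1_std p v - t * cnj (theta1_std p v)) / (1 - (complex_of_real t)\<^sup>2)) (rossi_frame t p)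
      + cscale c' (conj_vec (rossi_frame t p))"
    unfolding c_def a_def by blast
  fix d assume "\<exists>c0 c'. (v, 0) = cscale c0 ((\<i> * fst p, \<i> * snd p), 0)
      + cscale d (rossi_frame t p) + cscale c' (conj_vec (rossi_frame t p))"
  then obtain c0 c' where eq: "(v, 0) = cscale c0 ((\<i> * fst p, \<i> * snd p), 0)
      + cscale d (rossi_frame t p) + cscale c' (conj_vec (rossi_frame t p))" by blast
  have T: "theta1_std p (fst (cscale c0 ((\<i> * fst p, \<i> * snd p), 0))) = 0"
    "theta1_std p (snd (cscale c0 ((\<i> * fst p, \<i> * snd p), 0))) = 0"
    by (simp_all add: theta1_std_def cscale_def algebra_simps)
  \<comment> \<open>In the definition c' is not assumed to be the conjugate of d. Applying
    \<open>theta1_std\<close> to real and imaginary parts gives two equations, whose sum and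
    difference are a = d + t c' and cnj a = t d + c'.\<close>
  have A: "a = (d + t * cnj d) / 2 + (cnj c' + t * c') / 2"
    using arg_cong[OF eq, of "\<lambda>V. theta1_std p (fst V)"]
    by (simp add: theta1_std_add theta1_std_rossi[OF p] T a_def)
  have "0 = - \<i> * (d - t * cnj d) / 2 + \<i> * (cnj c' - t * c') / 2"
    using arg_cong[OF eq, of "\<lambda>V. theta1_std p (snd V)"]
    by (simp only: snd_conv snd_add theta1_std_add theta1_std_rossi[OF p] T) (simp add: theta1_std_def)
  then have "2 * \<i> * ((d - t * cnj d) - (cnj c' - t * c')) = 0" by (simp add: field_simps)
  then have B: "d - t * cnj d = cnj c' - t * c'" by simp
  have half: "2 * (x / 2 + y / 2) = x + y" for x y :: complex by (simp add: field_simps)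
  have A2: "2 * a = (d + t * cnj d) + (cnj c' + t * c')" unfolding A half ..
  have "2 * a = 2 * (d + t * c') - ((d - t * cnj d) - (cnj c' - t * c'))"
    unfolding A2 by (simp add: algebra_simps)
  then have "2 * a = 2 * (d + t * c')" unfolding B by (simp only: diff_self diff_zero)
  then have a1: "a = d + t * c'" by (simp only: mult_cancel_left) simp
  have "2 * a = 2 * (t * cnj d + cnj c') + ((d - t * cnj d) - (cnj c' - t * c'))"
    unfolding A2 by (simp add: algebra_simps)
  then have "2 * a = 2 * (t * cnj d + cnj c')" unfolding B by (simp only: diff_self add_0_right)
  then have "a = t * cnj d + cnj c'" by (simp only: mult_cancel_left) simp
  then have "cnj a = t * d + c'" by (metis complex_cnj_add complex_cnj_cnj complex_cnj_complex_of_real complex_cnj_mult)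
  then have "a - t * cnj a = d * (1 - t\<^sup>2)" using a1 by (simp add: algebra_simps power2_eq_square)
  then show "d = (theta1_std p v - t * cnj (theta1_std p v)) / (1 - (complex_of_real t)\<^sup>2)"
    using t2c by (simp add: a_def field_simps)
qed

lemma ext_deriv_theta1:
  assumes p: "p \<in> S3" and ab: "a \<in> tangent p" "b \<in> tangent p" and t: "\<bar>t\<bar> < 1"
  shows "ext_deriv (theta1 theta_S3 (rossi_frame t)) p a b
    = 2 * (theta1_std a b - t * cnj (theta1_std a b)) / (1 - (complex_of_real t)\<^sup>2)"
proof -
  define g where "g = (\<lambda>v q. (theta1_std q v - t * cnj (theta1_std q v)) / (1 - (complex_of_real t)\<^sup>2))"
  have d: "(g v has_derivative g v) (at p)" for v
    unfolding g_def
    by (rule linear_imp_has_derivative, rule linearI)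
      (simp_all add: theta1_std_def field_simps scaleR_conv_of_real add_divide_distrib[symmetric]
        diff_divide_distrib[symmetric])
  have sd: "sphere_deriv (\<lambda>q. theta1 theta_S3 (rossi_frame t) q (tangent_proj q v)) p x = g v x"
    if "x \<in> tangent p" for x v
    by (rule sphere_deriv_eq[OF p _ d that])
      (simp add: theta1_rossi tangent_proj_tangent t theta1_std_proj g_def)
  have "theta1_std b a = - theta1_std a b" by (simp add: theta1_std_def)
  then show ?thesis unfolding ext_deriv_sphere_deriv sd[OF ab(1)] sd[OF ab(2)]
    by (simp add: g_def diff_divide_distrib[symmetric] algebra_simps)
qed

lemma ext_deriv_theta_wedge:
  assumes "p \<in> S3" "a \<in> tangent p" "b \<in> tangent p"
  shows "ext_deriv theta_S3 p a b = \<i> * wedge (theta1_std p) (conj_form (theta1_std p)) a b"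
proof -
  define x y u v where "x = theta_S3 p a" and "y = theta_S3 p b" and "u = theta1_std p a" and "v = theta1_std p b"
  have r: "cnj x = x" "cnj y = y" by (simp_all add: x_def y_def theta_S3_eq)
  have p: "fst p * cnj (fst p) + snd p * cnj (snd p) = 1" using assms(1) by (rule S3_iff[THEN iffD1])
  have "herm_inner a b = (x * y + cnj u * v) * (fst p * cnj (fst p) + snd p * cnj (snd p))"
    unfolding herm_inner_def tangent_decomp[OF assms(1,2)] tangent_decomp[OF assms(1,3)]
    by (simp add: x_def[symmetric] y_def[symmetric] u_def[symmetric] v_def[symmetric] r algebra_simps)
  then have c: "herm_inner a b = x * y + cnj u * v" unfolding p by simp
  have "Im (x * y) = 0" using r by (simp add: complex_eq_iff)
  then show ?thesis
    unfolding ext_deriv_theta[OF assms] c wedge_def conj_form_def u_def[symmetric] v_def[symmetric]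
    by (simp add: complex_eq_iff)
qed

text \<open>By \<open>ext_deriv_theta1\<close> at t = 0 this is the structure equation of the
  standard sphere: connection form -2 \<i> \<theta> and no torsion.\<close>

lemma theta1_std_tangent:
  assumes "p \<in> S3" "a \<in> tangent p" "b \<in> tangent p"
  shows "theta1_std a b = - \<i> * (theta1_std p a * theta_S3 p b - theta1_std p b * theta_S3 p a)"
proof -
  define x y u v where "x = theta_S3 p a" and "y = theta_S3 p b" and "u = theta1_std p a" and "v = theta1_std p b"
  have p: "fst p * cnj (fst p) + snd p * cnj (snd p) = 1" using assms(1) by (rule S3_iff[THEN iffD1])
  have "theta1_std a b = - \<i> * (u * y - v * x) * (fst p * cnj (fst p) + snd p * cnj (snd p))"
    unfolding theta1_std_def[of a b] tangent_decomp[OF assms(1,2)] tangent_decomp[OF assms(1,3)]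
    by (simp add: x_def[symmetric] y_def[symmetric] u_def[symmetric] v_def[symmetric] algebra_simps)
  then show ?thesis unfolding p x_def y_def u_def v_def by simp
qed

lemma one_minus_sq_pos: "\<bar>t\<bar> < 1 \<Longrightarrow> 0 < 1 - (t::real)\<^sup>2"
  by (simp add: abs_square_less_1)

lemma one_minus_sq_ne: "\<bar>t\<bar> < 1 \<Longrightarrow> 1 - (complex_of_real t)\<^sup>2 \<noteq> 0"
  using one_minus_sq_pos[of t] by (metis less_irrefl of_real_0 of_real_1 of_real_diff of_real_eq_iff of_real_power)

lemma wedge_theta1_rossi:
  assumes "p \<in> S3" "a \<in> tangent p" "b \<in> tangent p" "\<bar>t\<bar> < 1"
  shows "wedge (theta1 theta_S3 (rossi_frame t) p) (theta1bar theta_S3 (rossi_frame t) p) a b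
    = wedge (theta1_std p) (conj_form (theta1_std p)) a b / (1 - (complex_of_real t)\<^sup>2)"
proof -
  define u v s where "u = theta1_std p a" and "v = theta1_std p b" and "s = 1 - (complex_of_real t)\<^sup>2"
  have s: "s \<noteq> 0" "cnj s = s" using one_minus_sq_ne[OF assms(4)] by (simp_all add: s_def)
  have q: "x / s * (y / s) = x * y / (s * s)" for x y :: complex by simp
  have "wedge (theta1 theta_S3 (rossi_frame t) p) (theta1bar theta_S3 (rossi_frame t) p) a b
    = (u - t * cnj u) / s * ((cnj v - t * v) / s) - (v - t * cnj v) / s * ((cnj u - t * u) / s)"
    using s(2) unfolding wedge_def theta1bar_def conj_form_def
      theta1_rossi[OF assms(1,2,4)] theta1_rossi[OF assms(1,3,4)]
    by (simp add: u_def[symmetric] v_def[symmetric] s_def)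
  also have "\<dots> = ((u - t * cnj u) * (cnj v - t * v) - (v - t * cnj v) * (cnj u - t * u)) / (s * s)"
    unfolding q by (rule diff_divide_distrib[symmetric])
  also have "(u - t * cnj u) * (cnj v - t * v) - (v - t * cnj v) * (cnj u - t * u) = (u * cnj v - v * cnj u) * s"
    by (simp add: s_def algebra_simps power2_eq_square)
  finally show ?thesis using s(1) by (simp add: wedge_def conj_form_def u_def v_def s_def)
qed

lemma levi_vector:
  assumes "p \<in> S3"
  shows "(c * cnj (snd p), - c * cnj (fst p)) \<in> tangent p"
    and "theta1_std p (c * cnj (snd p), - c * cnj (fst p)) = c"
    and "theta_S3 p (c * cnj (snd p), - c * cnj (fst p)) = 0"
proof -
  have p: "fst p * cnj (fst p) + snd p * cnj (snd p) = 1" using assms by (rule S3_iff[THEN iffD1])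
  have z: "herm_inner p (c * cnj (snd p), - c * cnj (fst p)) = 0" by (simp add: herm_inner_def)
  then show "(c * cnj (snd p), - c * cnj (fst p)) \<in> tangent p"
    and "theta_S3 p (c * cnj (snd p), - c * cnj (fst p)) = 0"
    by (simp_all add: tangent_iff theta_S3_eq)
  have "theta1_std p (c * cnj (snd p), - c * cnj (fst p)) = c * (fst p * cnj (fst p) + snd p * cnj (snd p))"
    by (simp add: theta1_std_def algebra_simps)
  then show "theta1_std p (c * cnj (snd p), - c * cnj (fst p)) = c" by (simp add: p)
qed

section \<open>Levi form, connection and torsion\<close>

lemma levi_rossi:
  assumes p: "p \<in> S3" and t: "\<bar>t\<bar> < 1"
  shows "levi theta_S3 (rossi_frame t) p = 1 - t\<^sup>2"
  unfolding levi_def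
proof (rule the_equality)
  note s = one_minus_sq_ne[OF t]
  show "\<forall>a\<in>tangent p. \<forall>b\<in>tangent p. ext_deriv theta_S3 p a b = \<i> * of_real (1 - t\<^sup>2)
      * wedge (theta1 theta_S3 (rossi_frame t) p) (theta1bar theta_S3 (rossi_frame t) p) a b"
  proof (intro ballI)
    fix a b assume ab: "a \<in> tangent p" "b \<in> tangent p"
    show "ext_deriv theta_S3 p a b = \<i> * of_real (1 - t\<^sup>2)
      * wedge (theta1 theta_S3 (rossi_frame t) p) (theta1bar theta_S3 (rossi_frame t) p) a b"
      unfolding wedge_theta1_rossi[OF p ab t] ext_deriv_theta_wedge[OF p ab] using s by simp
  qed
  fix l assume l: "\<forall>a\<in>tangent p. \<forall>b\<in>tangent p. ext_deriv theta_S3 p a b = \<i> * of_real l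
      * wedge (theta1 theta_S3 (rossi_frame t) p) (theta1bar theta_S3 (rossi_frame t) p) a b"
  \<comment> \<open>A real basis of the contact plane, on which the two-form does not vanish; it
    determines l.\<close>
  let ?a = "(1 * cnj (snd p), - 1 * cnj (fst p))" and ?b = "(\<i> * cnj (snd p), - \<i> * cnj (fst p))"
  have "\<i> * wedge (theta1_std p) (conj_form (theta1_std p)) ?a ?b
      = \<i> * of_real l * (wedge (theta1_std p) (conj_form (theta1_std p)) ?a ?b / (1 - (complex_of_real t)\<^sup>2))"
    using l levi_vector(1)[OF p] wedge_theta1_rossi[OF p _ _ t] ext_deriv_theta_wedge[OF p] by metis
  moreover have "wedge (theta1_std p) (conj_form (theta1_std p)) ?a ?b = - 2 * \<i>"
    unfolding wedge_def conj_form_def levi_vector(2)[OF p] by simp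
  ultimately have "2 * complex_of_real l = 2 * of_real (1 - t\<^sup>2)" using s by (simp add: field_simps)
  then have "complex_of_real l = of_real (1 - t\<^sup>2)" by (simp only: mult_cancel_left) simp
  then show "l = 1 - t\<^sup>2" by (simp only: of_real_eq_iff)
qed

text \<open>The constants come from d\<open>theta1_std\<close> = -2 \<i> \<open>theta1_std\<close>
  \<and> \<theta> by substituting \<open>theta1_std\<close> = \<theta>1 + t conj \<theta>1 into
  d\<theta>1. Existence of a solution makes the choice in \<open>tw_pair\<close> meaningful.\<close>

lemma tanaka_webster_rossi:
  assumes t: "\<bar>t\<bar> < 1"
  shows "tanaka_webster theta_S3 (rossi_frame t)
    (\<lambda>p v. - 2 * \<i> * (1 + t\<^sup>2) / (1 - (complex_of_real t)\<^sup>2) * theta_S3 p v) (\<lambda>p. 4 * \<i> * t / (1 - (complex_of_real t)\<^sup>2))"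
  unfolding tanaka_webster_def
proof (intro ballI conjI)
  fix p assume p: "p \<in> S3"
  define s where "s = 1 - (complex_of_real t)\<^sup>2"
  have s: "s \<noteq> 0" "cnj s = s" using one_minus_sq_ne[OF t] by (simp_all add: s_def)
  show "linear (\<lambda>v. - 2 * \<i> * (1 + t\<^sup>2) / (1 - (complex_of_real t)\<^sup>2) * theta_S3 p v)"
    by (rule linearI) (simp_all add: linear_add[OF linear_theta] linear_scale[OF linear_theta] distrib_left)
  fix a assume a: "a \<in> tangent p"
  { fix b assume b: "b \<in> tangent p"
    define x y u v where "x = theta_S3 p a" and "y = theta_S3 p b" and "u = theta1_std p a" and "v = theta1_std p b"
    have r: "cnj x = x" "cnj y = y" by (simp_all add: x_def y_def theta_S3_eq)
    have ab: "theta1_std a b = - \<i> * (u * y - v * x)"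
      unfolding u_def v_def x_def y_def by (rule theta1_std_tangent[OF p a b])
    have "ext_deriv (theta1 theta_S3 (rossi_frame t)) p a b
      = 2 * (- \<i> * (u * y - v * x) - t * (\<i> * (cnj u * y - cnj v * x))) * s / (s * s)"
      unfolding ext_deriv_theta1[OF p a b t] ab using s(1) by (simp add: r s_def)
    also have "2 * (- \<i> * (u * y - v * x) - t * (\<i> * (cnj u * y - cnj v * x))) * s
      = (- 2 * \<i> * (1 + t\<^sup>2)) * ((u - t * cnj u) * y - (v - t * cnj v) * x)
        + (4 * \<i> * t) * (x * (cnj v - t * v) - y * (cnj u - t * u))"
      by (simp add: s_def algebra_simps power2_eq_square)
    also have "\<dots> / (s * s)
      = (u - t * cnj u) / s * (- 2 * \<i> * (1 + t\<^sup>2) / s * y) - (v - t * cnj v) / s * (- 2 * \<i> * (1 + t\<^sup>2) / s * x)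
        + 4 * \<i> * t / s * (x * ((cnj v - t * v) / s) - y * ((cnj u - t * u) / s))"
      using s(1) by (simp add: field_simps)
    also have "\<dots> = wedge (theta1 theta_S3 (rossi_frame t) p) (\<lambda>v. - 2 * \<i> * (1 + t\<^sup>2) / (1 - (complex_of_real t)\<^sup>2) * theta_S3 p v) a b
        + 4 * \<i> * t / (1 - (complex_of_real t)\<^sup>2) * wedge (theta_S3 p) (theta1bar theta_S3 (rossi_frame t) p) a b"
      using s(2) unfolding wedge_def theta1bar_def conj_form_def theta1_rossi[OF p a t] theta1_rossi[OF p b t]
      by (simp add: s_def u_def v_def x_def y_def)
    finally show "ext_deriv (theta1 theta_S3 (rossi_frame t)) p a b
      = wedge (theta1 theta_S3 (rossi_frame t) p) (\<lambda>v. - 2 * \<i> * (1 + t\<^sup>2) / (1 - (complex_of_real t)\<^sup>2) * theta_S3 p v) a b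
        + 4 * \<i> * t / (1 - (complex_of_real t)\<^sup>2) * wedge (theta_S3 p) (theta1bar theta_S3 (rossi_frame t) p) a b" . }
  have "sphere_deriv (levi theta_S3 (rossi_frame t)) p a = 0"
    using sphere_deriv_eq[OF p levi_rossi[OF _ t] has_derivative_const a] .
  moreover have "cnj (theta_S3 p a) = theta_S3 p a" by (simp add: theta_S3_eq)
  ultimately show "complex_of_real (sphere_deriv (levi theta_S3 (rossi_frame t)) p a)
      = - 2 * \<i> * (1 + t\<^sup>2) / (1 - (complex_of_real t)\<^sup>2) * theta_S3 p a * of_real (levi theta_S3 (rossi_frame t) p)
        + of_real (levi theta_S3 (rossi_frame t) p)
          * conj_form (\<lambda>v. - 2 * \<i> * (1 + t\<^sup>2) / (1 - (complex_of_real t)\<^sup>2) * theta_S3 p v) a"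
    by (simp add: conj_form_def)
qed

lemma tanaka_webster_tw_pair:
  assumes "\<bar>t\<bar> < 1"
  shows "tanaka_webster theta_S3 (rossi_frame t) (omega11 theta_S3 (rossi_frame t)) (torsion theta_S3 (rossi_frame t))"
  unfolding omega11_def torsion_def tw_pair_def
  using someI[of "\<lambda>x. tanaka_webster theta_S3 (rossi_frame t) (fst x) (snd x)"]
    tanaka_webster_rossi[OF assms] by (metis fst_conv snd_conv)

lemma torsion_equations:
  fixes x y A W :: complex
  assumes "x \<noteq> 0" "y \<noteq> 0"
  shows "2 * \<i> * x / (x * y) = - (W / x) + A / x \<Longrightarrow> 2 * \<i> * x = y * (A - W)"
    and "- 2 * y / (x * y) = - (\<i> / y * W) - A * (\<i> / y) \<Longrightarrow> 2 * \<i> * y = x * (- A - W)"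
proof -
  assume "2 * \<i> * x / (x * y) = - (W / x) + A / x"
  then have "2 * \<i> * x / (x * y) = (A - W) / x" by (simp add: diff_divide_distrib)
  then show "2 * \<i> * x = y * (A - W)" using assms by (simp add: field_simps)
next
  assume "- 2 * y / (x * y) = - (\<i> / y * W) - A * (\<i> / y)"
  then have "- 2 * y / (x * y) = - \<i> * (A + W) / y" by (simp add: diff_divide_distrib add_divide_distrib algebra_simps)
  then have "\<i> * (2 * y) = \<i> * (\<i> * (A + W) * x)" using assms by (simp add: field_simps)
  then show "2 * \<i> * y = x * (- A - W)" by (simp add: algebra_simps)
qed

text \<open>The chosen pair is known only through the structure equations, so the values are
  recovered by evaluating these on the Reeb vector and a basis of the contact plane. As the
  connection form vanishes on the contact plane, the Kohn Laplacian and Q lose their connection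
  terms.\<close>

lemma
  assumes t: "\<bar>t\<bar> < 1" and p: "p \<in> S3"
  shows torsion_up_rossi: "torsion_up theta_S3 (rossi_frame t) p = - 4 * \<i> * t / (1 - (complex_of_real t)\<^sup>2)\<^sup>2"
    and omega11bar_rossi: "cext (omega11bar theta_S3 (rossi_frame t) p) (rossi_frame t p) = 0"
    and omega11bar_rossi_conj: "cext (omega11bar theta_S3 (rossi_frame t) p) (conj_vec (rossi_frame t p)) = 0"
proof -
  define \<omega> A where "\<omega> = omega11 theta_S3 (rossi_frame t) p" and "A = torsion theta_S3 (rossi_frame t) p"
  define e where "e = (\<lambda>c. (c * cnj (snd p), - c * cnj (fst p)))"
  define T where "T = (\<i> * fst p, \<i> * snd p)"
  have pp: "fst p * cnj (fst p) + snd p * cnj (snd p) = 1" using p by (rule S3_iff[THEN iffD1])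
  have e: "e c \<in> tangent p" "theta1_std p (e c) = c" "theta_S3 p (e c) = 0" for c
    unfolding e_def using levi_vector[OF p] by auto
  have "herm_inner p T = \<i> * (fst p * cnj (fst p) + snd p * cnj (snd p))"
    by (simp add: herm_inner_def T_def algebra_simps)
  then have T: "T \<in> tangent p" "theta_S3 p T = 1" "theta1_std p T = 0"
    unfolding pp by (simp_all add: tangent_iff theta_S3_eq theta1_std_def T_def)
  have s: "1 - (complex_of_real t)\<^sup>2 \<noteq> 0" by (rule one_minus_sq_ne[OF t])
  have f: "1 + complex_of_real t \<noteq> 0" "1 - complex_of_real t \<noteq> 0"
  proof -
    have "complex_of_real (1 + t) \<noteq> 0" "complex_of_real (1 - t) \<noteq> 0"
      unfolding of_real_eq_0_iff using t by auto
    then show "1 + complex_of_real t \<noteq> 0" "1 - complex_of_real t \<noteq> 0" by simp_all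
  qed
  have fac: "1 - (complex_of_real t)\<^sup>2 = (1 + complex_of_real t) * (1 - complex_of_real t)" by (simp add: power2_eq_square algebra_simps)
  have lin: "linear \<omega>"
    using tanaka_webster_tw_pair[OF t] p unfolding tanaka_webster_def \<omega>_def by blast
  have se: "ext_deriv (theta1 theta_S3 (rossi_frame t)) p a b
      = wedge (theta1 theta_S3 (rossi_frame t) p) \<omega> a b + A * wedge (theta_S3 p) (theta1bar theta_S3 (rossi_frame t) p) a b"
      if "a \<in> tangent p" "b \<in> tangent p" for a b
    using tanaka_webster_tw_pair[OF t] that p unfolding tanaka_webster_def \<omega>_def A_def by blast
  have skew: "\<omega> a + cnj (\<omega> a) = 0" if "a \<in> tangent p" for a
  proof -
    have "of_real (sphere_deriv (levi theta_S3 (rossi_frame t)) p a)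
      = \<omega> a * of_real (levi theta_S3 (rossi_frame t) p) + of_real (levi theta_S3 (rossi_frame t) p) * conj_form \<omega> a"
      using tanaka_webster_tw_pair[OF t] that p unfolding tanaka_webster_def \<omega>_def A_def by blast
    moreover have "sphere_deriv (levi theta_S3 (rossi_frame t)) p a = 0"
      using sphere_deriv_eq[OF p levi_rossi[OF _ t] has_derivative_const that] .
    ultimately have "(1 - (complex_of_real t)\<^sup>2) * (\<omega> a + cnj (\<omega> a)) = 0"
      by (simp add: levi_rossi[OF p t] conj_form_def algebra_simps)
    then show ?thesis using s by simp
  qed
  have th: "theta1 theta_S3 (rossi_frame t) p (e 1) = 1 / (1 + complex_of_real t)"
    "theta1 theta_S3 (rossi_frame t) p (e \<i>) = \<i> / (1 - complex_of_real t)"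
    "theta1 theta_S3 (rossi_frame t) p T = 0"
  proof -
    have "\<i> - complex_of_real t * cnj \<i> = \<i> * (1 + complex_of_real t)" by (simp add: algebra_simps)
    then show "theta1 theta_S3 (rossi_frame t) p (e \<i>) = \<i> / (1 - complex_of_real t)"
      unfolding theta1_rossi[OF p e(1) t] e fac using f by simp
    show "theta1 theta_S3 (rossi_frame t) p (e 1) = 1 / (1 + complex_of_real t)"
      unfolding theta1_rossi[OF p e(1) t] e fac using f by simp
    show "theta1 theta_S3 (rossi_frame t) p T = 0"
      unfolding theta1_rossi[OF p T(1) t] T by simp
  qed
  have S: "2 * (theta1_std a b - t * cnj (theta1_std a b)) / ((1 + complex_of_real t) * (1 - complex_of_real t))
      = theta1 theta_S3 (rossi_frame t) p a * \<omega> b - theta1 theta_S3 (rossi_frame t) p b * \<omega> a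
      + A * (theta_S3 p a * cnj (theta1 theta_S3 (rossi_frame t) p b)
        - theta_S3 p b * cnj (theta1 theta_S3 (rossi_frame t) p a))" if "a \<in> tangent p" "b \<in> tangent p" for a b
    using se[OF that] unfolding ext_deriv_theta1[OF p that t] fac
    by (simp add: wedge_def theta1bar_def conj_form_def)
  \<comment> \<open>The structure equation on the contact plane says that one value is a real
    multiple of \<i> times the other. Both are purely imaginary by \<open>skew\<close>, hence both
    are 0.\<close>
  have "1 / (1 + complex_of_real t) * \<omega> (e \<i>) - \<i> / (1 - complex_of_real t) * \<omega> (e 1) = 0"
    using S[OF e(1) e(1), of 1 \<i>] theta1_std_tangent[OF p e(1) e(1), of 1 \<i>] by (simp add: th e)
  then have w: "(1 - complex_of_real t) * \<omega> (e \<i>) = \<i> * (1 + complex_of_real t) * \<omega> (e 1)"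
    using f by (simp add: field_simps)
  have im: "Re (\<omega> (e c)) = 0" for c using skew[OF e(1), of c] by (simp add: complex_eq_iff)
  have t1: "1 + t \<noteq> 0" "1 - t \<noteq> 0" using t by auto
  have "\<omega> (e 1) = 0 \<and> \<omega> (e \<i>) = 0"
    using w im[of 1] im[of \<i>] t1 by (auto simp: complex_eq_iff)
  then have w0: "\<omega> (e 1) = 0" "\<omega> (e \<i>) = 0" by auto
  \<comment> \<open>Pairing the Reeb vector with \<open>e 1\<close> and \<open>e \<i>\<close> gives
    two equations for A and \<open>\<omega> T\<close>, from which the latter is eliminated.\<close>
  have "theta1_std T (e c) = \<i> * c" for c
    using theta1_std_tangent[OF p T(1) e(1)] by (simp add: e T)
  then have E: "2 * (\<i> + complex_of_real t * \<i>) / ((1 + complex_of_real t) * (1 - complex_of_real t)) = - (\<omega> T / (1 + complex_of_real t)) + A / (1 + complex_of_real t)"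
    "2 * (- 1 + complex_of_real t) / ((1 + complex_of_real t) * (1 - complex_of_real t)) = - (\<i> / (1 - complex_of_real t) * \<omega> T) - A * (\<i> / (1 - complex_of_real t))"
    using S[OF T(1) e(1), of 1] S[OF T(1) e(1), of \<i>] by (simp_all add: th e T w0 mult_ac)
  have "2 * (\<i> + complex_of_real t * \<i>) = 2 * \<i> * (1 + complex_of_real t)" "2 * (- 1 + complex_of_real t) = - 2 * (1 - complex_of_real t)"
    by (simp_all add: algebra_simps)
  note E' = E[unfolded this]
  have w1: "2 * \<i> * (1 + complex_of_real t) = (1 - complex_of_real t) * (A - \<omega> T)" and w2: "2 * \<i> * (1 - complex_of_real t) = (1 + complex_of_real t) * (- A - \<omega> T)"
    using torsion_equations(1)[OF f E'(1)] torsion_equations(2)[OF f E'(2)] by simp_all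
  have "2 * A * ((1 + complex_of_real t) * (1 - complex_of_real t))
    = (1 - complex_of_real t) * (A - \<omega> T) * (1 + complex_of_real t)
      - (1 + complex_of_real t) * (- A - \<omega> T) * (1 - complex_of_real t)"
    by (simp add: algebra_simps)
  also have "\<dots> = 2 * \<i> * (1 + complex_of_real t) * (1 + complex_of_real t)
      - 2 * \<i> * (1 - complex_of_real t) * (1 - complex_of_real t)"
    unfolding w1 w2 ..
  also have "\<dots> = 2 * (4 * \<i> * t)" by (simp add: algebra_simps)
  finally have "2 * (A * ((1 + complex_of_real t) * (1 - complex_of_real t))) = 2 * (4 * \<i> * t)"
    by (simp only: mult.assoc)
  then have "A * ((1 + complex_of_real t) * (1 - complex_of_real t)) = 4 * \<i> * t"
    by (simp only: mult_cancel_left) simp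
  then have "A = 4 * \<i> * t / ((1 + complex_of_real t) * (1 - complex_of_real t))"
    using f by (subst nonzero_eq_divide_eq) (simp_all add: mult_ac)
  then show "torsion_up theta_S3 (rossi_frame t) p = - 4 * \<i> * t / (1 - (complex_of_real t)\<^sup>2)\<^sup>2"
    unfolding torsion_up_def levi_rossi[OF p t] A_def[symmetric] fac[symmetric]
    by (simp add: power2_eq_square[of "1 - (complex_of_real t)\<^sup>2"])
  have wr: "\<omega> (r *\<^sub>R e 1) = 0" "\<omega> (r *\<^sub>R e \<i>) = 0" for r
    by (simp_all add: linear_scale[OF lin] w0)
  have Z: "fst (rossi_frame t p) = ((1 + t) / 2) *\<^sub>R e 1" "snd (rossi_frame t p) = (- (1 - t) / 2) *\<^sub>R e \<i>"
    by (simp_all add: rossi_frame_eq e_def scaleR_conv_of_real field_simps)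
  show "cext (omega11bar theta_S3 (rossi_frame t) p) (rossi_frame t p) = 0"
    unfolding cext_def omega11bar_def conj_form_def \<omega>_def[symmetric] Z wr by simp
  show "cext (omega11bar theta_S3 (rossi_frame t) p) (conj_vec (rossi_frame t p)) = 0"
    unfolding cext_def omega11bar_def conj_form_def \<omega>_def[symmetric] conj_vec_def fst_conv snd_conv
      linear_neg[OF lin] Z wr by simp
qed

section \<open>Action of the frame on polynomials in z and cnj w\<close>

lemma vf_apply_rossi:
  assumes "p \<in> S3" "\<And>q. q \<in> S3 \<Longrightarrow> u q = g q" "(g has_derivative g') (at p)"
  shows "vf_apply (rossi_frame t) u p = cext g' (rossi_frame t p)"
    and "vf_apply (\<lambda>q. conj_vec (rossi_frame t q)) u p = cext g' (conj_vec (rossi_frame t p))"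
proof -
  have tan: "fst (rossi_frame t p) \<in> tangent p" "snd (rossi_frame t p) \<in> tangent p" "- snd (rossi_frame t p) \<in> tangent p"
    by (simp_all add: tangent_iff herm_inner_def rossi_frame_eq field_simps)
  have sd: "sphere_deriv u p a = g' a" if "a \<in> tangent p" for a
    by (rule sphere_deriv_eq[OF assms(1) _ assms(3) that]) (rule assms(2))
  show "vf_apply (rossi_frame t) u p = cext g' (rossi_frame t p)"
    and "vf_apply (\<lambda>q. conj_vec (rossi_frame t q)) u p = cext g' (conj_vec (rossi_frame t p))"
    by (simp_all only: vf_apply_def cext_def conj_vec_def fst_conv snd_conv tan[THEN sd])
qed

text \<open>\<open>A\<close> and \<open>B\<close> are the derivatives by z and cnj w. The other
  Wirtinger derivatives vanish, which reduces the frame to the operators encoded by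
  \<open>coeff_Z\<close> and \<open>coeff_Zbar\<close>.\<close>

lemma cext_wirtinger:
  fixes A B k :: complex and t :: real
  defines "g' \<equiv> \<lambda>v. k * (A * fst v + B * cnj (snd v))"
  shows "cext g' (rossi_frame t p) = k * (A * cnj (snd p) - t * B * fst p)"
    and "cext g' (conj_vec (rossi_frame t p)) = k * (t * A * cnj (snd p) - B * fst p)"
    and "cext (\<lambda>v. cnj (g' v)) (rossi_frame t p) = cnj (cext g' (conj_vec (rossi_frame t p)))"
    and "cext (\<lambda>v. cnj (g' v)) (conj_vec (rossi_frame t p)) = cnj (cext g' (rossi_frame t p))"
  unfolding g'_def cext_def conj_vec_def rossi_frame_eq
  by (simp_all add: field_simps)

definition hom_poly :: "int \<Rightarrow> (int \<Rightarrow> real) \<Rightarrow> c2 \<Rightarrow> complex" where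
  "hom_poly m c p = (\<Sum>a\<in>{0..m}. c a * (fst p ^ nat a * cnj (snd p) ^ nat (m - a)))"

lemma hom_poly_lin: "hom_poly m (\<lambda>i. a * c i + b * d i) p = a * hom_poly m c p + b * hom_poly m d p"
  by (simp add: hom_poly_def sum_distrib_left sum.distrib algebra_simps)

definition deriv_z :: "int \<Rightarrow> (int \<Rightarrow> real) \<Rightarrow> c2 \<Rightarrow> complex" where
  "deriv_z m c p = (\<Sum>a\<in>{0..m}. c a * (of_nat (nat a) * fst p ^ (nat a - 1) * cnj (snd p) ^ nat (m - a)))"

definition deriv_wbar :: "int \<Rightarrow> (int \<Rightarrow> real) \<Rightarrow> c2 \<Rightarrow> complex" where
  "deriv_wbar m c p = (\<Sum>a\<in>{0..m}. c a * (fst p ^ nat a * (of_nat (nat (m - a)) * cnj (snd p) ^ (nat (m - a) - 1))))"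

lemma has_derivative_hom_poly:
  "(hom_poly m c has_derivative (\<lambda>v. deriv_z m c p * fst v + deriv_wbar m c p * cnj (snd v))) (at p)"
proof -
  have s: "((\<lambda>p. c a * (fst p ^ nat a * cnj (snd p) ^ nat (m - a))) has_derivative
    (\<lambda>v. c a * (of_nat (nat a) * fst p ^ (nat a - 1) * cnj (snd p) ^ nat (m - a)) * fst v
      + c a * (fst p ^ nat a * (of_nat (nat (m - a)) * cnj (snd p) ^ (nat (m - a) - 1))) * cnj (snd v))) (at p)"
    (is "(_ has_derivative ?f') _") for a
  proof -
    have 1: "((\<lambda>p::c2. fst p ^ nat a) has_derivative (\<lambda>v. of_nat (nat a) * fst p ^ (nat a - 1) * fst v)) (at p)"
      by (auto intro!: derivative_eq_intros simp: mult_ac)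
    have "((\<lambda>p::c2. cnj (snd p)) has_derivative (\<lambda>v. cnj (snd v))) (at p)"
      by (intro derivative_intros)
    then have 2: "((\<lambda>p::c2. cnj (snd p) ^ nat (m - a)) has_derivative
        (\<lambda>v. of_nat (nat (m - a)) * cnj (snd p) ^ (nat (m - a) - 1) * cnj (snd v))) (at p)"
      by (auto intro!: derivative_eq_intros simp: mult_ac)
    show ?thesis
      by (rule has_derivative_eq_rhs[OF has_derivative_mult_right[OF has_derivative_mult[OF 1 2]]])
        (simp add: fun_eq_iff algebra_simps)
  qed
  show ?thesis unfolding hom_poly_def[abs_def] deriv_z_def deriv_wbar_def
    by (rule has_derivative_eq_rhs[OF has_derivative_sum[OF s]]) (simp add: sum_distrib_right sum.distrib)
qed

lemma deriv_z_times_wbar: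
  assumes "c \<in> hom_coeffs m"
  shows "deriv_z m c p * cnj (snd p) = hom_poly m (\<lambda>a. real_of_int (a + 1) * c (a + 1)) p"
proof -
  have "deriv_z m c p * cnj (snd p)
    = (\<Sum>a\<in>{1..m}. c a * (of_nat (nat a) * fst p ^ (nat a - 1) * cnj (snd p) ^ nat (m - a)) * cnj (snd p))"
    unfolding deriv_z_def sum_distrib_right by (rule sum.mono_neutral_right) auto
  also have "\<dots> = (\<Sum>a\<in>{0..<m}. (real_of_int (a + 1) * c (a + 1)) * (fst p ^ nat a * cnj (snd p) ^ nat (m - a)))"
  proof (rule sum.reindex_bij_witness[of _ "\<lambda>a. a + 1" "\<lambda>a. a - 1"])
    fix a assume a: "a \<in> {1..m}"
    then have n: "nat (m - (a - 1)) = Suc (nat (m - a))" "nat (a - 1) = nat a - 1" "real (nat a) = real_of_int a"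
      by auto
    show "complex_of_real (real_of_int (a - 1 + 1) * c (a - 1 + 1)) * (fst p ^ nat (a - 1) * cnj (snd p) ^ nat (m - (a - 1)))
      = c a * (of_nat (nat a) * fst p ^ (nat a - 1) * cnj (snd p) ^ nat (m - a)) * cnj (snd p)"
      using a unfolding n by (simp add: algebra_simps)
  qed auto
  also have "\<dots> = hom_poly m (\<lambda>a. real_of_int (a + 1) * c (a + 1)) p"
    unfolding hom_poly_def by (rule sum.mono_neutral_left) (use assms in \<open>auto simp: hom_coeffs_def\<close>)
  finally show ?thesis .
qed

lemma deriv_wbar_times_z:
  assumes "c \<in> hom_coeffs m"
  shows "deriv_wbar m c p * fst p = hom_poly m (\<lambda>a. real_of_int (m - a + 1) * c (a - 1)) p"
proof -
  have "deriv_wbar m c p * fst p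
    = (\<Sum>a\<in>{0..<m}. c a * (fst p ^ nat a * (of_nat (nat (m - a)) * cnj (snd p) ^ (nat (m - a) - 1))) * fst p)"
    unfolding deriv_wbar_def sum_distrib_right by (rule sum.mono_neutral_right) auto
  also have "\<dots> = (\<Sum>a\<in>{1..m}. (real_of_int (m - a + 1) * c (a - 1)) * (fst p ^ nat a * cnj (snd p) ^ nat (m - a)))"
  proof (rule sum.reindex_bij_witness[of _ "\<lambda>a. a - 1" "\<lambda>a. a + 1"])
    fix a assume a: "a \<in> {0..<m}"
    then have n: "nat (a + 1) = Suc (nat a)" "nat (m - (a + 1)) = nat (m - a) - 1" "real (nat (m - a)) = real_of_int (m - a)"
      by auto
    show "complex_of_real (real_of_int (m - (a + 1) + 1) * c (a + 1 - 1)) * (fst p ^ nat (a + 1) * cnj (snd p) ^ nat (m - (a + 1)))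
      = c a * (fst p ^ nat a * (of_nat (nat (m - a)) * cnj (snd p) ^ (nat (m - a) - 1))) * fst p"
      using a unfolding n by (simp add: algebra_simps)
  qed auto
  also have "\<dots> = hom_poly m (\<lambda>a. real_of_int (m - a + 1) * c (a - 1)) p"
    unfolding hom_poly_def by (rule sum.mono_neutral_left) (use assms in \<open>auto simp: hom_coeffs_def\<close>)
  finally show ?thesis .
qed

lemma hom_poly_coeff_Z:
  assumes "c \<in> hom_coeffs m"
  shows "hom_poly m (coeff_Z t m c) p = deriv_z m c p * cnj (snd p) - t * deriv_wbar m c p * fst p"
proof -
  have "hom_poly m (coeff_Z t m c) p = hom_poly m (\<lambda>a. 1 * (real_of_int (a + 1) * c (a + 1))
      + (- t) * (real_of_int (m - a + 1) * c (a - 1))) p"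
    by (simp add: coeff_Z_def[abs_def] algebra_simps)
  then show ?thesis unfolding hom_poly_lin deriv_z_times_wbar[OF assms, symmetric] deriv_wbar_times_z[OF assms, symmetric]
    by (simp add: mult.assoc)
qed

lemma hom_poly_coeff_Zbar:
  assumes "c \<in> hom_coeffs m"
  shows "hom_poly m (coeff_Zbar t m c) p = t * deriv_z m c p * cnj (snd p) - deriv_wbar m c p * fst p"
proof -
  have "hom_poly m (coeff_Zbar t m c) p = hom_poly m (\<lambda>a. t * (real_of_int (a + 1) * c (a + 1))
      + (- 1) * (real_of_int (m - a + 1) * c (a - 1))) p"
    by (simp add: coeff_Zbar_def[abs_def] algebra_simps)
  then show ?thesis unfolding hom_poly_lin deriv_z_times_wbar[OF assms, symmetric] deriv_wbar_times_z[OF assms, symmetric]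
    by (simp add: mult.assoc)
qed

text \<open>The hypothesis concerns the sphere only, because the result of one differentiation is
  known only there; this allows iteration. The constant k carries the Levi and torsion factors
  along.\<close>

lemma
  assumes c: "c \<in> hom_coeffs m" and u: "\<And>q. q \<in> S3 \<Longrightarrow> u q = k * hom_poly m c q" and p: "p \<in> S3"
  shows vf_apply_hom_poly: "vf_apply (rossi_frame t) u p = k * hom_poly m (coeff_Z t m c) p"
    and vf_apply_conj_hom_poly: "vf_apply (\<lambda>q. conj_vec (rossi_frame t q)) u p = k * hom_poly m (coeff_Zbar t m c) p"
proof -
  have "((\<lambda>q. k * hom_poly m c q) has_derivative (\<lambda>v. k * (deriv_z m c p * fst v + deriv_wbar m c p * cnj (snd v)))) (at p)"
    by (intro has_derivative_mult_right has_derivative_hom_poly)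
  from vf_apply_rossi[OF p u this]
  show "vf_apply (rossi_frame t) u p = k * hom_poly m (coeff_Z t m c) p"
    and "vf_apply (\<lambda>q. conj_vec (rossi_frame t q)) u p = k * hom_poly m (coeff_Zbar t m c) p"
    by (simp_all add: cext_wirtinger hom_poly_coeff_Z[OF c] hom_poly_coeff_Zbar[OF c])
qed

lemma
  assumes c: "c \<in> hom_coeffs m" and u: "\<And>q. q \<in> S3 \<Longrightarrow> u q = cnj (k * hom_poly m c q)" and p: "p \<in> S3"
  shows vf_apply_cnj_hom_poly: "vf_apply (rossi_frame t) u p = cnj (k * hom_poly m (coeff_Zbar t m c) p)"
    and vf_apply_conj_cnj_hom_poly: "vf_apply (\<lambda>q. conj_vec (rossi_frame t q)) u p = cnj (k * hom_poly m (coeff_Z t m c) p)"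
proof -
  have "((\<lambda>q. cnj (k * hom_poly m c q)) has_derivative
      (\<lambda>v. cnj (k * (deriv_z m c p * fst v + deriv_wbar m c p * cnj (snd v))))) (at p)"
    by (intro has_derivative_cnj has_derivative_mult_right has_derivative_hom_poly)
  from vf_apply_rossi[OF p u this]
  show "vf_apply (rossi_frame t) u p = cnj (k * hom_poly m (coeff_Zbar t m c) p)"
    and "vf_apply (\<lambda>q. conj_vec (rossi_frame t q)) u p = cnj (k * hom_poly m (coeff_Z t m c) p)"
    by (simp_all only: cext_wirtinger hom_poly_coeff_Z[OF c] hom_poly_coeff_Zbar[OF c])
qed

lemma paneitz_hom_poly:
  assumes t: "\<bar>t\<bar> < 1" and c: "c \<in> hom_coeffs m" and p: "p \<in> S3"
  shows "paneitz theta_S3 (rossi_frame t) (hom_poly m c) p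
    = hom_poly m (coeff_paneitz t m c) p / (1 - (complex_of_real t)\<^sup>2)\<^sup>2"
proof -
  define s where "s = 1 - (complex_of_real t)\<^sup>2"
  have ls: "complex_of_real (1 / levi theta_S3 (rossi_frame t) q) = 1 / s" if "q \<in> S3" for q
    by (simp add: levi_rossi[OF that t] s_def)
  have cs: "cnj s = s" by (simp add: s_def)
  let ?Z = "coeff_Z t m" and ?W = "coeff_Zbar t m"
  have h: "?W c \<in> hom_coeffs m" "?Z (?W c) \<in> hom_coeffs m" "?Z (?Z (?W c)) \<in> hom_coeffs m"
    by (intro coeff_Z_hom coeff_Zbar_hom c)+
  have v1: "vf_apply (\<lambda>q. conj_vec (rossi_frame t q)) (hom_poly m c) q = 1 * hom_poly m (?W c) q" if "q \<in> S3" for q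
    by (rule vf_apply_conj_hom_poly[OF c _ that]) simp
  have v1': "vf_apply (rossi_frame t) (vf_apply (\<lambda>q. conj_vec (rossi_frame t q)) (hom_poly m c)) q
      = 1 * hom_poly m (?Z (?W c)) q" if "q \<in> S3" for q
    by (rule vf_apply_hom_poly[OF h(1) _ that]) (rule v1)
  have kl: "kohn_laplacian theta_S3 (rossi_frame t) (hom_poly m c) q = - (1 / s) * hom_poly m (?Z (?W c)) q"
    if "q \<in> S3" for q
    unfolding kohn_laplacian_def Let_def omega11bar_rossi[OF t that] ls[OF that] v1'[OF that] by simp
  \<comment> \<open>\<open>kohn_laplacian_conj\<close> conjugates its argument, which leaves
    polynomials in z and cnj w; on their conjugates the frame and its conjugate exchange
    roles.\<close>
  define v where "v = (\<lambda>q. cnj (kohn_laplacian theta_S3 (rossi_frame t) (hom_poly m c) q))"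
  have v: "v q = cnj (- (1 / s) * hom_poly m (?Z (?W c)) q)" if "q \<in> S3" for q
    unfolding v_def kl[OF that] ..
  have v2: "vf_apply (\<lambda>q. conj_vec (rossi_frame t q)) v q = cnj (- (1 / s) * hom_poly m (?Z (?Z (?W c))) q)"
    if "q \<in> S3" for q
    by (rule vf_apply_conj_cnj_hom_poly[OF h(2) v that])
  have v3: "vf_apply (rossi_frame t) (vf_apply (\<lambda>q. conj_vec (rossi_frame t q)) v) p
      = cnj (- (1 / s) * hom_poly m (?W (?Z (?Z (?W c)))) p)"
    by (rule vf_apply_cnj_hom_poly[OF h(3) v2 p])
  have 1: "kohn_laplacian_conj theta_S3 (rossi_frame t) (kohn_laplacian theta_S3 (rossi_frame t) (hom_poly m c)) p
    = 1 / s * (1 / s) * hom_poly m (?W (?Z (?Z (?W c)))) p"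
    unfolding kohn_laplacian_conj_def v_def[symmetric] kohn_laplacian_def[of _ _ v]
      Let_def omega11bar_rossi[OF t p] ls[OF p] v3
    by (simp add: cs)
  have tv: "torsion_up theta_S3 (rossi_frame t) q * vf_apply (\<lambda>q. conj_vec (rossi_frame t q)) (hom_poly m c) q
    = - 4 * \<i> * t / s\<^sup>2 * hom_poly m (?W c) q" if "q \<in> S3" for q
    unfolding torsion_up_rossi[OF t that] v1[OF that] s_def by simp
  have tv': "vf_apply (\<lambda>q. conj_vec (rossi_frame t q)) (\<lambda>q. torsion_up theta_S3 (rossi_frame t) q
      * vf_apply (\<lambda>q. conj_vec (rossi_frame t q)) (hom_poly m c) q) p = - 4 * \<i> * t / s\<^sup>2 * hom_poly m (?W (?W c)) p"
    by (rule vf_apply_conj_hom_poly[OF h(1) tv p])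
  have 2: "Q_op theta_S3 (rossi_frame t) (hom_poly m c) p = 4 * t / s\<^sup>2 * hom_poly m (?W (?W c)) p"
    unfolding Q_op_def Let_def tv' omega11bar_rossi_conj[OF t p] by (simp add: mult_ac)
  have "hom_poly m (coeff_paneitz t m c) p
    = hom_poly m (\<lambda>a. 1 * ?W (?Z (?Z (?W c))) a + (4 * t) * ?W (?W c) a) p"
    by (simp add: coeff_paneitz_def[abs_def])
  then show ?thesis unfolding paneitz_def 1 2 hom_poly_lin s_def[symmetric]
    by (simp add: power2_eq_square[of s] add_divide_distrib)
qed

section \<open>Square-integrable eigenfunctions\<close>

inductive real_poly :: "(c2 \<Rightarrow> complex) \<Rightarrow> bool" where
  const: "real_poly (\<lambda>_. k)"
| fst: "real_poly fst"
| snd: "real_poly (\<lambda>p. cnj (snd p))"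
| add: "real_poly f \<Longrightarrow> real_poly g \<Longrightarrow> real_poly (\<lambda>p. f p + g p)"
| mult: "real_poly f \<Longrightarrow> real_poly g \<Longrightarrow> real_poly (\<lambda>p. f p * g p)"

text \<open>The class is closed under derivatives in a fixed direction, which is the induction step
  for \<open>Ck_on\<close>.\<close>

lemma real_poly_derivative:
  "real_poly f \<Longrightarrow> \<exists>f'. (\<forall>p. (f has_derivative f' p) (at p)) \<and> (\<forall>v. real_poly (\<lambda>p. f' p v))"
proof (induction rule: real_poly.induct)
  case (const k)
  show ?case by (rule exI[of _ "\<lambda>_ _. 0"]) (auto intro: real_poly.const)
next
  case fst
  have "(fst has_derivative fst) (at p)" for p :: c2 by (intro derivative_intros)
  then show ?case by (intro exI[of _ "\<lambda>_. fst"]) (auto intro: real_poly.const)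
next
  case snd
  have "((\<lambda>p. cnj (snd p)) has_derivative (\<lambda>v. cnj (snd v))) (at p)" for p :: c2 by (intro derivative_intros)
  then show ?case by (intro exI[of _ "\<lambda>_ v. cnj (snd v)"]) (auto intro: real_poly.const)
next
  case (add f g)
  then obtain f' g' where *: "\<And>p. (f has_derivative f' p) (at p)" "\<And>v. real_poly (\<lambda>p. f' p v)"
    "\<And>p. (g has_derivative g' p) (at p)" "\<And>v. real_poly (\<lambda>p. g' p v)" by blast
  show ?case
    by (rule exI[of _ "\<lambda>p v. f' p v + g' p v"]) (auto intro!: * has_derivative_add real_poly.add)
next
  case (mult f g)
  then obtain f' g' where *: "\<And>p. (f has_derivative f' p) (at p)" "\<And>v. real_poly (\<lambda>p. f' p v)"
    "\<And>p. (g has_derivative g' p) (at p)" "\<And>v. real_poly (\<lambda>p. g' p v)" by blast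
  show ?case
    by (rule exI[of _ "\<lambda>p v. f p * g' p v + f' p v * g p"])
      (auto intro!: * mult.hyps has_derivative_mult real_poly.add real_poly.mult)
qed

lemma real_poly_Ck: "real_poly f \<Longrightarrow> Ck_on k UNIV f"
proof (induction k arbitrary: f)
  case 0
  obtain f' where "\<And>p. (f has_derivative f' p) (at p)" using real_poly_derivative[OF 0] by blast
  then have "isCont f p" for p by (rule has_derivative_continuous)
  then show ?case by (simp add: continuous_at_imp_continuous_on)
next
  case (Suc k)
  obtain f' where f': "\<And>p. (f has_derivative f' p) (at p)" "\<And>v. real_poly (\<lambda>p. f' p v)"
    using real_poly_derivative[OF Suc.prems] by blast
  then have "frechet_derivative f (at p) = f' p" for p using frechet_derivative_at by metis
  moreover have "f differentiable at p" for p unfolding differentiable_def using f'(1) by blast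
  ultimately show ?case using f'(2) Suc.IH by simp
qed

lemma real_poly_power: "real_poly f \<Longrightarrow> real_poly (\<lambda>p. f p ^ n)"
  by (induction n) (auto intro: real_poly.intros)

lemma real_poly_sum: "finite A \<Longrightarrow> (\<And>a. a \<in> A \<Longrightarrow> real_poly (f a)) \<Longrightarrow> real_poly (\<lambda>p. \<Sum>a\<in>A. f a p)"
  by (induction A rule: finite_induct) (auto intro: real_poly.intros)

lemma smooth_hom_poly: "smooth_S3 (hom_poly m c)"
proof -
  have "real_poly (hom_poly m c)"
    unfolding hom_poly_def[abs_def]
    by (intro real_poly_sum real_poly.mult real_poly.const real_poly_power real_poly.fst real_poly.snd) simp
  then show ?thesis unfolding smooth_S3_def using real_poly_Ck by (intro exI[of _ UNIV] exI[of _ "hom_poly m c"]) auto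
qed

lemma continuous_hom_poly: "continuous_on A (hom_poly m c)"
  unfolding hom_poly_def[abs_def] by (intro continuous_intros)

section \<open>The volume measure in Hopf coordinates\<close>

lemma hopf_S3: "hopf y \<in> S3"
proof -
  obtain \<eta> \<alpha> \<beta> where y: "y = (\<eta>, \<alpha>, \<beta>)" by (cases y)
  have "norm (hopf y) = sqrt ((cos \<eta>)\<^sup>2 + (sin \<eta>)\<^sup>2)"
    by (simp add: y hopf_def norm_Pair norm_mult)
  then show ?thesis by (simp add: add.commute)
qed

lemma has_derivative_hopf:
  "(hopf has_derivative (\<lambda>v.
     (of_real (- sin \<eta> * fst v) * cis \<alpha> + of_real (cos \<eta>) * (\<i> * cis \<alpha> * of_real (fst (snd v))),
      of_real (cos \<eta> * fst v) * cis \<beta> + of_real (sin \<eta>) * (\<i> * cis \<beta> * of_real (snd (snd v)))))) (at (\<eta>, \<alpha>, \<beta>))"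
proof -
  have "hopf = (\<lambda>y. (of_real (cos (fst y)) * exp (\<i> * of_real (fst (snd y))),
      of_real (sin (fst y)) * exp (\<i> * of_real (snd (snd y)))))"
    by (rule ext) (simp add: hopf_def cis_conv_exp split: prod.split)
  moreover have "((\<lambda>y::real \<times> real \<times> real. (complex_of_real (cos (fst y)) * exp (\<i> * of_real (fst (snd y))),
      complex_of_real (sin (fst y)) * exp (\<i> * of_real (snd (snd y))))) has_derivative (\<lambda>v.
     (of_real (- sin \<eta> * fst v) * cis \<alpha> + of_real (cos \<eta>) * (\<i> * cis \<alpha> * of_real (fst (snd v))),
      of_real (cos \<eta> * fst v) * cis \<beta> + of_real (sin \<eta>) * (\<i> * cis \<beta> * of_real (snd (snd v)))))) (at (\<eta>, \<alpha>, \<beta>))"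
  proof -
    have E: "((\<lambda>y. exp (\<i> * complex_of_real (h y))) has_derivative (\<lambda>v. \<i> * of_real (h v) * exp (\<i> * of_real (h x)))) (at x)"
      if "(h has_derivative h) (at x)" for h :: "real \<times> real \<times> real \<Rightarrow> real" and x
    proof -
      have "((\<lambda>y. \<i> * complex_of_real (h y)) has_derivative (\<lambda>v. \<i> * of_real (h v))) (at x)"
        by (intro has_derivative_mult_right has_derivative_of_real that)
      from has_derivative_compose[OF this, of exp "(*) (exp (\<i> * of_real (h x)))"]
      show ?thesis using DERIV_exp[of "\<i> * of_real (h x)"] by (simp add: has_field_derivative_def mult_ac)
    qed
    have S: "((\<lambda>y. fst (snd y)) has_derivative (\<lambda>y. fst (snd y))) (at x)"
      "((\<lambda>y. snd (snd y)) has_derivative (\<lambda>y. snd (snd y))) (at x)" for x :: "real \<times> real \<times> real"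
      by (intro derivative_intros)+
    show ?thesis
      by (auto intro!: derivative_eq_intros E S simp: cis_conv_exp algebra_simps fun_eq_iff)
  qed
  ultimately show ?thesis by simp
qed

lemma continuous_hopf: "continuous_on A hopf"
proof -
  have "isCont hopf y" for y
    using has_derivative_continuous[OF has_derivative_hopf] by (cases y) simp
  then show ?thesis by (simp add: continuous_at_imp_continuous_on)
qed

lemma vol_density:
  "(let D = frechet_derivative hopf (at y)
    in norm (vol_form theta_S3 (hopf y) (D (1, 0, 0)) (D (0, 1, 0)) (D (0, 0, 1))))
   = 2 * \<bar>sin (fst y) * cos (fst y)\<bar>"
proof -
  obtain \<eta> \<alpha> \<beta> where y: "y = (\<eta>, \<alpha>, \<beta>)" by (cases y)
  define C S where "C = complex_of_real (cos \<eta>)" and "S = complex_of_real (sin \<eta>)"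
  define A B where "A = cis \<alpha>" and "B = cis \<beta>"
  have CS: "cnj C = C" "cnj S = S" "C * C + S * S = 1"
    by (simp_all only: C_def S_def complex_cnj_complex_of_real of_real_mult[symmetric] of_real_add[symmetric]
        sin_cos_squared_add3 of_real_1)
  have AB: "cnj A * A = 1" "A * cnj A = 1" "cnj B * B = 1" "B * cnj B = 1"
    by (simp_all add: A_def B_def cis_cnj cis_mult)
  \<comment> \<open>The vectors a, b, c are the images of the coordinate vectors; \<theta> vanishes
    on a, so two terms of the volume form remain.\<close>
  define p a b c where "p = hopf y" and "a = (- S * A, C * B)" and "b = (\<i> * C * A, 0::complex)" and "c = (0::complex, \<i> * S * B)"
  have p: "p = (C * A, S * B)" by (simp add: p_def y hopf_def C_def S_def A_def B_def)
  have p3: "p \<in> S3" unfolding p_def by (rule hopf_S3)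
  have "herm_inner p a = - C * S * (cnj A * A) + C * S * (cnj B * B)" "herm_inner p b = \<i> * (C * C) * (cnj A * A)"
    "herm_inner p c = \<i> * (S * S) * (cnj B * B)" "herm_inner a b = - \<i> * (S * C) * (cnj A * A)"
    "herm_inner c a = - \<i> * (S * C) * (cnj B * B)" "herm_inner b c = 0"
    by (simp_all add: herm_inner_def p a_def b_def c_def CS algebra_simps)
  then have ci: "herm_inner p a = 0" "herm_inner p b = \<i> * (C * C)" "herm_inner p c = \<i> * (S * S)"
    "herm_inner a b = - \<i> * (S * C)" "herm_inner c a = - \<i> * (S * C)" "herm_inner b c = 0"
    unfolding AB by simp_all
  have tan: "a \<in> tangent p" "b \<in> tangent p" "c \<in> tangent p"
    by (simp_all add: tangent_iff ci C_def S_def)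
  have D: "frechet_derivative hopf (at y) = (\<lambda>v.
     (of_real (- sin \<eta> * fst v) * cis \<alpha> + of_real (cos \<eta>) * (\<i> * cis \<alpha> * of_real (fst (snd v))),
      of_real (cos \<eta> * fst v) * cis \<beta> + of_real (sin \<eta>) * (\<i> * cis \<beta> * of_real (snd (snd v)))))"
    unfolding y by (rule frechet_derivative_at[symmetric, OF has_derivative_hopf])
  have Da: "frechet_derivative hopf (at y) (1, 0, 0) = a" "frechet_derivative hopf (at y) (0, 1, 0) = b"
    "frechet_derivative hopf (at y) (0, 0, 1) = c"
    unfolding D by (simp_all add: a_def b_def c_def C_def S_def A_def B_def mult_ac)
  have re: "Im (\<i> * (C * C)) = (cos \<eta>)\<^sup>2" "Im (\<i> * (S * S)) = (sin \<eta>)\<^sup>2" "Im (- \<i> * (S * C)) = - (sin \<eta> * cos \<eta>)"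
    by (simp_all add: C_def S_def power2_eq_square)
  have "vol_form theta_S3 p a b c = complex_of_real (- 2 * (sin \<eta> * cos \<eta>) * ((cos \<eta>)\<^sup>2 + (sin \<eta>)\<^sup>2))"
    unfolding vol_form_def ext_deriv_theta[OF p3 tan(2,3)] ext_deriv_theta[OF p3 tan(3,1)] ext_deriv_theta[OF p3 tan(1,2)]
      theta_S3_eq ci re
    by (simp only: of_real_mult of_real_add of_real_minus) (simp add: algebra_simps)
  also have "\<dots> = complex_of_real (- 2 * (sin \<eta> * cos \<eta>))"
    by (simp only: sin_cos_squared_add2 mult_1_right)
  finally have "vol_form theta_S3 p a b c = complex_of_real (- 2 * (sin \<eta> * cos \<eta>))" .
  then show ?thesis unfolding Let_def Da p_def[symmetric] by (simp add: y abs_mult del: of_real_mult of_real_minus)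
qed

definition hopf_box :: "(real \<times> real \<times> real) set" where
  "hopf_box = box (0, 0, 0) (pi / 2, 2 * pi, 2 * pi)"

definition hopf_measure :: "(real \<times> real \<times> real) measure" where
  "hopf_measure = density (restrict_space lborel hopf_box) (\<lambda>y. ennreal (2 * \<bar>sin (fst y) * cos (fst y)\<bar>))"

lemma density_measurable:
  "(\<lambda>y. ennreal (2 * \<bar>sin (fst y) * cos (fst y)\<bar>)) \<in> borel_measurable (restrict_space lborel hopf_box)"
proof -
  have "(\<lambda>y::real \<times> real \<times> real. 2 * \<bar>sin (fst y) * cos (fst y)\<bar>) \<in> borel_measurable lborel"
    unfolding measurable_lborel2 by (intro borel_measurable_continuous_onI continuous_intros)
  then show ?thesis by (intro measurable_restrict_space1 measurable_compose[OF _ measurable_ennreal])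
qed

lemma vol_theta: "vol theta_S3 = distr hopf_measure (restrict_space borel S3) hopf"
  unfolding vol_def hopf_measure_def hopf_box_def vol_density[unfolded Let_def] Let_def ..

lemma hopf_measurable: "hopf \<in> hopf_measure \<rightarrow>\<^sub>M restrict_space borel S3"
proof (rule measurable_restrict_space2)
  have "hopf \<in> borel_measurable lborel"
    using continuous_hopf[of UNIV] by (simp add: borel_measurable_continuous_onI)
  then show "hopf \<in> borel_measurable hopf_measure"
    unfolding hopf_measure_def by (simp add: measurable_restrict_space1)
qed (rule funcsetI, rule hopf_S3)

lemma finite_measure_vol: "finite_measure (vol theta_S3)"
  unfolding vol_theta
proof (rule finite_measure.finite_measure_distr[OF _ hopf_measurable])
  have "emeasure hopf_measure (space hopf_measure)
    = (\<integral>\<^sup>+y. ennreal (2 * \<bar>sin (fst y) * cos (fst y)\<bar>) * indicator (space (restrict_space lborel hopf_box)) y \<partial>restrict_space lborel hopf_box)"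
    unfolding hopf_measure_def by (subst emeasure_density[OF density_measurable]) auto
  also have "\<dots> \<le> (\<integral>\<^sup>+y. ennreal 2 \<partial>restrict_space lborel hopf_box)"
  proof (rule nn_integral_mono)
    fix y :: "real \<times> real \<times> real"
    have "\<bar>sin (fst y) * cos (fst y)\<bar> \<le> 1 * 1"
      unfolding abs_mult by (intro mult_mono) auto
    then have "ennreal (2 * \<bar>sin (fst y) * cos (fst y)\<bar>) \<le> ennreal 2" by (intro ennreal_leI) simp
    then show "ennreal (2 * \<bar>sin (fst y) * cos (fst y)\<bar>) * indicator (space (restrict_space lborel hopf_box)) y \<le> ennreal 2"
      by (auto simp: indicator_def)
  qed
  also have "\<dots> = 2 * emeasure lborel hopf_box"
    by (simp add: emeasure_restrict_space space_restrict_space hopf_box_def)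
  also have "\<dots> < \<infinity>"
    using emeasure_lborel_box_finite[of "(0, 0, 0)" "(pi / 2, 2 * pi, 2 * pi)"]
    by (simp add: hopf_box_def ennreal_mult_less_top less_top)
  finally show "finite_measure hopf_measure" by (intro finite_measureI) auto
qed

section \<open>Polynomials as nonzero elements of the Hilbert space\<close>

lemma L2_hom_poly: "(\<lambda>x. k * hom_poly m c x) \<in> L2 theta_S3"
proof -
  interpret finite_measure "vol theta_S3" by (rule finite_measure_vol)
  have cont: "continuous_on A (\<lambda>x. k * hom_poly m c x)" for A
    by (intro continuous_intros continuous_hom_poly)
  have sp: "space (vol theta_S3) = S3" by (simp add: vol_theta space_restrict_space)
  have "(\<lambda>x. k * hom_poly m c x) \<in> borel_measurable (restrict_space borel S3)"
    using cont by (rule borel_measurable_continuous_on_restrict)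
  then have meas: "(\<lambda>x. k * hom_poly m c x) \<in> borel_measurable (vol theta_S3)"
    by (simp add: vol_theta)
  have "compact ((\<lambda>x. k * hom_poly m c x) ` S3)" by (intro compact_continuous_image cont compact_sphere)
  then obtain M where M: "\<And>x. x \<in> S3 \<Longrightarrow> norm (k * hom_poly m c x) \<le> M"
    by (metis bounded_iff compact_imp_bounded imageI)
  have "integrable (vol theta_S3) (\<lambda>x. (norm (k * hom_poly m c x))\<^sup>2)"
  proof (rule integrable_const_bound[of _ "M\<^sup>2"])
    show "AE x in vol theta_S3. norm ((norm (k * hom_poly m c x))\<^sup>2) \<le> M\<^sup>2"
      using M by (intro AE_I2) (auto simp: sp intro!: power_mono simp del: norm_mult)
  qed (use meas in measurable)
  then show ?thesis using meas by (simp add: L2_def)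
qed

text \<open>A continuous function vanishing almost everywhere on the open coordinate box vanishes on
  all of it. On a slice with real z and w, homogeneity leaves a polynomial in z / w with infinitely
  many roots.\<close>

lemma hom_poly_not_AE_zero:
  assumes c: "c \<in> hom_coeffs m" "c \<noteq> (\<lambda>_. 0)"
  shows "\<not> (AE x in vol theta_S3. hom_poly m c x = 0)"
proof
  assume ae: "AE x in vol theta_S3. hom_poly m c x = 0"
  define N where "N = {y \<in> hopf_box. hom_poly m c (hopf y) \<noteq> 0}"
  have hb: "open hopf_box" "hopf_box \<in> sets lborel" by (auto simp: hopf_box_def)
  have "{x \<in> space (restrict_space borel S3). hom_poly m c x = 0} \<in> sets (restrict_space borel S3)"
    using borel_measurable_continuous_on_restrict[OF continuous_hom_poly[of S3 m c]]
    by measurable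
  then have "AE y in hopf_measure. hom_poly m c (hopf y) = 0"
    using ae unfolding vol_theta by (subst (asm) AE_distr_iff[OF hopf_measurable]) auto
  then have "AE y in restrict_space lborel hopf_box. 0 < ennreal (2 * \<bar>sin (fst y) * cos (fst y)\<bar>) \<longrightarrow> hom_poly m c (hopf y) = 0"
    unfolding hopf_measure_def by (subst (asm) AE_density[OF density_measurable])
  then have "AE y in lborel. y \<in> hopf_box \<longrightarrow> 0 < ennreal (2 * \<bar>sin (fst y) * cos (fst y)\<bar>) \<longrightarrow> hom_poly m c (hopf y) = 0"
    using hb by (subst (asm) AE_restrict_space_iff) auto
  then have "AE y in lborel. y \<notin> N"
  proof (rule AE_mp, intro AE_I2 impI)
    fix y assume y: "y \<in> hopf_box \<longrightarrow> 0 < ennreal (2 * \<bar>sin (fst y) * cos (fst y)\<bar>) \<longrightarrow> hom_poly m c (hopf y) = 0"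
    \<comment> \<open>The density is positive on the box, so its null sets there are Lebesgue null
      sets.\<close>
    have "0 < sin (fst y) * cos (fst y)" if "y \<in> hopf_box"
    proof -
      have "0 < fst y" "fst y < pi / 2" using that by (auto simp: hopf_box_def box_def Basis_prod_def inner_prod_def)
      then show ?thesis by (intro mult_pos_pos sin_gt_zero cos_gt_zero_pi) auto
    qed
    then show "y \<notin> N" using y by (auto simp: N_def)
  qed
  have "open N"
  proof -
    have "continuous_on hopf_box (\<lambda>y. hom_poly m c (hopf y))"
      by (rule continuous_on_compose2[OF continuous_hom_poly[of UNIV] continuous_hopf]) simp
    moreover have "N = hopf_box \<inter> (\<lambda>y. hom_poly m c (hopf y)) -` (- {0})" by (auto simp: N_def)
    ultimately show ?thesis using hb(1) by (simp add: continuous_open_preimage open_Compl)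
  qed
  have "N = {}"
  proof (rule ccontr)
    assume "N \<noteq> {}"
    then have "\<not> negligible N" using \<open>open N\<close> open_not_negligible by blast
    moreover have "N \<in> null_sets lborel"
      using \<open>AE y in lborel. y \<notin> N\<close> \<open>open N\<close> by (subst AE_iff_null_sets) auto
    ultimately show False by (simp add: negligible_iff_null_sets null_sets_completionI)
  qed
  have m: "0 \<le> m"
  proof (rule ccontr)
    assume "\<not> 0 \<le> m"
    then have "c a = 0" for a using c(1) by (simp add: hom_coeffs_def)
    then show False using c(2) by blast
  qed
  have root: "(\<Sum>i\<le>nat m. c (int i) * x ^ i) = 0" if x: "0 < x" for x
  proof -
    \<comment> \<open>This angle gives z / w = x. Both phases are taken as \<pi> because phase 0
      lies on the boundary of the open box.\<close>
    define \<eta> where "\<eta> = arctan (1 / x)"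
    have \<eta>: "0 < \<eta>" "\<eta> < pi / 2" using x arctan_ubound[of "1 / x"] by (auto simp: \<eta>_def)
    then have s: "0 < sin \<eta>" by (intro sin_gt_zero) auto
    have "0 < cos \<eta>" using \<eta> by (intro cos_gt_zero_pi) auto
    moreover have "sin \<eta> / cos \<eta> = 1 / x" using tan_arctan[of "1 / x"] by (simp add: tan_def \<eta>_def)
    ultimately have cs: "cos \<eta> = x * sin \<eta>" using x by (simp add: field_simps)
    have "(\<eta>, pi, pi) \<in> hopf_box" using \<eta> by (auto simp: hopf_box_def box_def Basis_prod_def inner_prod_def)
    then have z: "hom_poly m c (hopf (\<eta>, pi, pi)) = 0" using \<open>N = {}\<close> by (auto simp: N_def)
    have "hom_poly m c (hopf (\<eta>, pi, pi))
      = (\<Sum>a\<in>{0..m}. complex_of_real (- sin \<eta>) ^ nat m * of_real (c a * x ^ nat a))"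
      unfolding hom_poly_def
    proof (rule sum.cong)
      fix a assume a: "a \<in> {0..m}"
      then have e: "nat m = nat a + nat (m - a)" by auto
      have h: "fst (hopf (\<eta>, pi, pi)) = of_real x * of_real (- sin \<eta>)" "cnj (snd (hopf (\<eta>, pi, pi))) = of_real (- sin \<eta>)"
        by (simp_all add: hopf_def cs)
      show "complex_of_real (c a) * (fst (hopf (\<eta>, pi, pi)) ^ nat a * cnj (snd (hopf (\<eta>, pi, pi))) ^ nat (m - a))
        = complex_of_real (- sin \<eta>) ^ nat m * of_real (c a * x ^ nat a)"
        unfolding h e power_add power_mult_distrib by (simp add: mult_ac)
    qed simp
    also have "\<dots> = complex_of_real (- sin \<eta>) ^ nat m * of_real (\<Sum>a\<in>{0..m}. c a * x ^ nat a)"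
      by (simp add: sum_distrib_left)
    finally have "complex_of_real (- sin \<eta>) ^ nat m * of_real (\<Sum>a\<in>{0..m}. c a * x ^ nat a) = 0" using z by simp
    then have "(\<Sum>a\<in>{0..m}. c a * x ^ nat a) = 0" using s by (simp only: mult_eq_0_iff power_eq_0_iff of_real_eq_0_iff) simp
    moreover have "(\<Sum>a\<in>{0..m}. c a * x ^ nat a) = (\<Sum>i\<le>nat m. c (int i) * x ^ i)"
      by (rule sum.reindex_bij_witness[of _ int nat]) (use m in auto)
    ultimately show ?thesis by simp
  qed
  have "infinite {x::real. 0 < x}" using infinite_Ioi[of "0::real"] by (simp add: greaterThan_def)
  then have "infinite {x. (\<Sum>i\<le>nat m. c (int i) * x ^ i) = 0}"
    by (rule infinite_super[rotated]) (use root in auto)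
  then have z: "c (int i) = 0" if "i \<le> nat m" for i
    using polyfun_finite_roots[of "\<lambda>i. c (int i)" "nat m"] that by auto
  have "c a = 0" for a
  proof (cases "a \<in> {0..m}")
    case True
    then show ?thesis using z[of "nat a"] by auto
  qed (use c(1) in \<open>auto simp: hom_coeffs_def\<close>)
  then show False using c(2) by blast
qed

text \<open>A polynomial is itself an admissible \<psi> in \<open>formal_adjoint\<close>, so the
  distributional eigenvalue equation is the pointwise one, integrated against \<phi>.\<close>

lemma paneitz_eigenvalue_hom_poly:
  assumes t: "\<bar>t\<bar> < 1" and c: "c \<in> hom_coeffs m" "c \<noteq> (\<lambda>_. 0)"
    and ev: "coeff_paneitz t m c = (\<lambda>a. r * c a)"
  shows "paneitz_eigenvalue theta_S3 (rossi_frame t) (complex_of_real (r / (1 - t\<^sup>2)\<^sup>2))"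
  unfolding paneitz_eigenvalue_def max_extension_def
proof (intro exI conjI allI impI)
  let ?k = "complex_of_real (r / (1 - t\<^sup>2)\<^sup>2)"
  show "hom_poly m c \<in> L2 theta_S3" using L2_hom_poly[of 1 m c] by simp
  show "(\<lambda>x. ?k * hom_poly m c x) \<in> L2 theta_S3" by (rule L2_hom_poly)
  show "\<not> (AE x in vol theta_S3. hom_poly m c x = 0)" by (rule hom_poly_not_AE_zero[OF c])
  fix \<phi> \<phi>' assume "formal_adjoint theta_S3 (paneitz theta_S3 (rossi_frame t)) \<phi> \<phi>'"
  then have "L2_inner theta_S3 (hom_poly m c) \<phi>' = L2_inner theta_S3 (paneitz theta_S3 (rossi_frame t) (hom_poly m c)) \<phi>"
    unfolding formal_adjoint_def using smooth_hom_poly[of m c] by simp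
  also have "\<dots> = L2_inner theta_S3 (\<lambda>x. ?k * hom_poly m c x) \<phi>"
    unfolding L2_inner_def
  proof (rule Bochner_Integration.integral_cong)
    fix p assume "p \<in> space (vol theta_S3)"
    then have p: "p \<in> S3" by (simp add: vol_theta space_restrict_space)
    have "hom_poly m (\<lambda>a. r * c a) p = r * hom_poly m c p"
      using hom_poly_lin[of m r c 0 c p] by simp
    then show "paneitz theta_S3 (rossi_frame t) (hom_poly m c) p * cnj (\<phi> p) = ?k * hom_poly m c p * cnj (\<phi> p)"
      unfolding paneitz_hom_poly[OF t c(1) p] ev by simp
  qed simp
  finally show "L2_inner theta_S3 (hom_poly m c) \<phi>' = L2_inner theta_S3 (\<lambda>x. ?k * hom_poly m c x) \<phi>" .
qed

theorem theorem1p3: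
  fixes t :: real
  assumes "0 < \<bar>t\<bar>" and "\<bar>t\<bar> < 1"
  shows "infinite {r :: real. r < 0 \<and>
           paneitz_eigenvalue theta_S3 (rossi_frame t) (complex_of_real r)}"
proof
  let ?E = "{r :: real. r < 0 \<and> paneitz_eigenvalue theta_S3 (rossi_frame t) (complex_of_real r)}"
  define s where "s = (1 - t\<^sup>2)\<^sup>2"
  have s: "0 < s" using one_minus_sq_pos[OF assms(2)] by (simp add: s_def)
  have small: "\<exists>r\<in>?E. - \<epsilon> < r" if "0 < \<epsilon>" for \<epsilon>
  proof -
    have "0 < \<epsilon> * s" using that s by simp
    then obtain m r c where "- (\<epsilon> * s) < r" "r < 0" "c \<in> hom_coeffs m" "c \<noteq> (\<lambda>_. 0)"
      "coeff_paneitz t m c = (\<lambda>a. r * c a)"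
      by (rule coeff_paneitz_eigenvector[OF assms])
    then have "r / s \<in> ?E" "- \<epsilon> < r / s"
      using paneitz_eigenvalue_hom_poly[OF assms(2)] s
      by (auto simp: s_def[symmetric] field_simps simp del: of_real_divide)
    then show ?thesis by blast
  qed
  assume fin: "finite ?E"
  have ne: "?E \<noteq> {}" using small[of 1] by auto
  have "Max ?E \<in> ?E" by (rule Max_in[OF fin ne])
  \<comment> \<open>The largest eigenvalue is negative, and taking \<epsilon> as its absolute value
    produces a larger one.\<close>
  then obtain r where "r \<in> ?E" "- (- Max ?E) < r" using small[of "- Max ?E"] by auto
  then show False using Max_ge[OF fin] by fastforce
qed

end
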